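(* Let $t$ be a positive even integer. Then, as formal power series in $q$ with coefficients in $\mathbb{Z}[x]$, $$\sum_{\lambda\in \mathcal{SC}} x^{n_t(\lambda)}\, q^{\vert\lambda\vert} = (-q;q^2)_{\infty}\cdot \big((1-x^2)q^{2t};q^{2t}\big)_{\infty}^{t/2}.$$
   Context: A partition $\lambda=(\lambda_1\ge\lambda_2\ge\dots\ge\lambda_\ell\ge 1)$ has size $|\lambda|=\sum_i\lambda_i$ (the empty partition has size $0$). Its Young diagram has $\lambda_i$ left-justified cells in row $i$. The conjugate $\lambda'$ is the partition whose Young diagram is the reflection of that of $\lambda$ in the main diagonal; $\lambda$ is self-conjugate if $\lambda=\lambda'$, and $\mathcal{SC}$ denotes the set of all self-conjugate partitions (including the empty one). The hook length of the cell $(i,j)$ in the Young diagram of $\lambda$ is the number of cells directly to its right in row $i$, plus the number of cells directly below it in column $j$, plus $1$. For a positive integer $t$, $n_t(\lambda)$ is the number of cells of $\lambda$ whose hook length equals $t$. The $q$-Pochhammer symbol is $(a;q)_0=1$, $(a;q)_n=\prod_{j=0}^{n-1}(1-aq^j)$ for $n\ge1$, and $(a;q)_\infty=\prod_{j\ge0}(1-aq^j)$. *)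

theory Defs
  imports "HOL-Computational_Algebra.Computational_Algebra"
begin

definition is_partition :: "nat list \<Rightarrow> bool" where
  "is_partition lam \<longleftrightarrow> sorted_wrt (\<ge>) lam \<and> (\<forall>x\<in>set lam. 0 < x)"

definition psize :: "nat list \<Rightarrow> nat" where
  "psize lam = sum_list lam"

definition in_diagram :: "nat list \<Rightarrow> nat \<Rightarrow> nat \<Rightarrow> bool" where
  "in_diagram lam i j \<longleftrightarrow> i < length lam \<and> j < lam ! i"

definition conj_part :: "nat list \<Rightarrow> nat list" where
  "conj_part lam = map (\<lambda>j. length (filter (\<lambda>x. j < x) lam)) [0..<(if lam = [] then 0 else hd lam)]"

definition self_conjugate :: "nat list \<Rightarrow> bool" where
  "self_conjugate lam \<longleftrightarrow> is_partition lam \<and> conj_part lam = lam"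

definition hook_length :: "nat list \<Rightarrow> nat \<Rightarrow> nat \<Rightarrow> nat" where
  "hook_length lam i j = (lam ! i - j - 1) + (conj_part lam ! j - i - 1) + 1"

definition n_hook :: "nat \<Rightarrow> nat list \<Rightarrow> nat" where
  "n_hook t lam = card {(i, j). in_diagram lam i j \<and> hook_length lam i j = t}"

text \<open>Infinite q-Pochhammer symbol (a;b)_\<infinity> in formal power series, as the limit
  (in the standard fps metric) of the finite products.\<close>
definition qpoch_inf :: "'a::comm_ring_1 fps \<Rightarrow> 'a fps \<Rightarrow> 'a fps" where
  "qpoch_inf a b = lim (\<lambda>N. \<Prod>j<N. (1 - a * b ^ j))"

definition sc_hook_gf :: "nat \<Rightarrow> int poly fps" where
  "sc_hook_gf t = Abs_fps (\<lambda>n. \<Sum>lam\<in>{lam. self_conjugate lam \<and> psize lam = n}. monom 1 (n_hook t lam))"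

end

theory Submission
  imports Defs
begin

text \<open>A partition inside an \<open>N \<times> N\<close> box is a set \<open>T\<close> of \<open>N\<close> beads in \<open>{0, \<dots>, 2N - 1}\<close>; hooks of
  length \<open>t\<close> are the beads that can move \<open>t\<close> places down to a gap, and conjugation is the mirror
  \<open>k \<mapsto> 2N - 1 - k\<close> combined with complementation. For \<open>N = tM\<close> with \<open>t\<close> even, the mirror exchanges
  the residue classes \<open>r\<close> and \<open>t - 1 - r\<close>, so a self-conjugate partition is given by arbitrary
  subsets of the classes \<open>r < t/2\<close>, each possible move counts twice, and the generating function is
  a product over \<open>r < t/2\<close>. On one class the moves are the ascents of a word. Words with \<open>a\<close> zeros
  and \<open>b\<close> ones, weighted by inversions (\<open>Q = q\<^sup>2\<^sup>t\<close>) and ascents (\<open>y = x\<^sup>2\<close>), have a generating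
  function that tends to \<open>\<Prod>\<^sub>k (1 + (y - 1) Q\<^sup>k) / (1 - Q\<^sup>k)\<close>. Hence marking the moves multiplies each
  class by \<open>\<Prod>\<^sub>k (1 + (y - 1) Q\<^sup>k)\<close>, whereas at \<open>x = 1\<close> the total is just the sum over sets of
  diagonal hooks, \<open>\<Prod> (1 + q\<^sup>2\<^sup>d\<^sup>+\<^sup>1)\<close>. All comparisons are made modulo \<open>q\<^sup>M\<close>.\<close>

subsection \<open>Words and their ascents\<close>

text \<open>Elements are the ones of a word: an ascent is a zero followed by a one, on a residue
  class a bead that can slide down to a gap.\<close>

definition ascents :: "nat set \<Rightarrow> nat" where
  "ascents A = card {k \<in> A. 0 < k \<and> k - 1 \<notin> A}"

text \<open>A set \<open>A\<close> of \<open>b\<close> elements stands for a word with \<open>b\<close> ones and \<open>a\<close> zeros, and the exponent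
  of \<open>Q\<close> is its number of inversions; the subtraction does not truncate.\<close>

definition ascent_gf :: "'a::comm_ring_1 \<Rightarrow> 'a \<Rightarrow> nat \<Rightarrow> nat \<Rightarrow> 'a" where
  "ascent_gf y Q a b =
    (\<Sum>A | A \<subseteq> {..<a + b} \<and> card A = b. y ^ ascents A * Q ^ (\<Sum>A - \<Sum>{..<b}))"

text \<open>A set of \<open>Suc b\<close> naturals has maximum at least \<open>b\<close>; remove it
  and induct. This makes the subtraction in \<open>ascent_gf\<close> exact.\<close>

lemma sum_card_le:
  fixes A :: "nat set"
  assumes "finite A"
  shows "\<Sum>{..<card A} \<le> \<Sum>A"
  using assms
proof (induction "card A" arbitrary: A)
  case 0
  then show ?case by simp
next
  case (Suc b)
  then have ne: "A \<noteq> {}" by auto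
  let ?m = "Max A"
  have m: "?m \<in> A" using ne Suc by simp
  have "A \<subseteq> {..?m}" using Suc by auto
  then have "card A \<le> card {..?m}" by (intro card_mono) auto
  then have le: "b \<le> ?m" using Suc(2) by simp
  have card: "card (A - {?m}) = b" using Suc(2,3) m by (metis card_Diff_singleton diff_Suc_1)
  then have "\<Sum>{..<b} \<le> \<Sum>(A - {?m})"
    using Suc(1)[of "A - {?m}"] Suc(3) by simp
  moreover have "\<Sum>A = ?m + \<Sum>(A - {?m})" using Suc m by (simp add: sum.remove)
  moreover have "\<Sum>{..<card A} = b + \<Sum>{..<b}" using Suc(2) by (metis add.commute sum.lessThan_Suc)
  ultimately show ?case using le by linarith
qed

lemma ascents_lessThan: "ascents {..<b} = 0"
proof -
  have "{k \<in> {..<b}. 0 < k \<and> k - 1 \<notin> {..<b}} = {}" by auto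
  then show ?thesis by (simp add: ascents_def)
qed

lemma ascents_insert:
  assumes "A \<subseteq> {..<Suc L}"
  shows "ascents (insert (Suc L) A) = ascents A + (if L \<in> A then 0 else 1)"
proof -
  have fin: "finite A" using assms finite_subset by blast
  have "{k \<in> insert (Suc L) A. 0 < k \<and> k - 1 \<notin> insert (Suc L) A} =
      {k \<in> A. 0 < k \<and> k - 1 \<notin> A} \<union> (if L \<in> A then {} else {Suc L})"
    using assms by (auto split: if_splits)
  moreover have "Suc L \<notin> A" using assms by auto
  ultimately show ?thesis using fin by (simp add: ascents_def)
qed

lemma ascent_gf_0_left: "ascent_gf y Q 0 b = 1"
proof -
  have "A = {..<b}" if "A \<subseteq> {..<b}" "card A = b" for A
    using that by (intro card_subset_eq) auto
  then have "{A. A \<subseteq> {..<0 + b} \<and> card A = b} = {{..<b}}" by auto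
  then show ?thesis by (simp add: ascent_gf_def ascents_lessThan)
qed

lemma ascent_gf_0_right: "ascent_gf y Q a 0 = 1"
proof -
  have "{A. A \<subseteq> {..<a + 0} \<and> card A = 0} = {{}}"
    by (auto dest: finite_subset)
  then show ?thesis by (simp add: ascent_gf_def ascents_def)
qed

text \<open>Split by the last letter. A final one has \<open>Suc a\<close> zeros before it, giving
  \<open>Q ^ Suc a\<close>; writing the factor of a possible new ascent as
  \<open>y = 1 + (y - 1)\<close> leaves a correction only where the preceding letter is a zero, and
  removing that zero gives the last term.\<close>

lemma ascent_gf_Suc:
  "ascent_gf y Q (Suc a) (Suc b) =
    ascent_gf y Q a (Suc b) + Q ^ Suc a * ascent_gf y Q (Suc a) b
      + (y - 1) * Q ^ Suc a * ascent_gf y Q a b"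
proof -
  define L where "L = a + b"
  define f where "f b A = y ^ ascents A * Q ^ (\<Sum>A - \<Sum>{..<b})" for b A
  define S where "S = {A. A \<subseteq> {..<Suc L} \<and> card A = b}"
  have fin: "finite A" if "A \<subseteq> {..<n}" for A and n :: nat
    using that finite_subset by blast
  have finS: "finite {A. A \<subseteq> {..<n} \<and> card A = c}" for n c :: nat
    by (rule finite_subset[of _ "Pow {..<n}"]) auto
  have notin: "Suc L \<notin> A" if "A \<in> S" for A
    using that by (auto simp: S_def)
  have split: "{A. A \<subseteq> {..<Suc (Suc L)} \<and> card A = Suc b} =
      {A. A \<subseteq> {..<Suc L} \<and> card A = Suc b} \<union> insert (Suc L) ` S" (is "?X = ?Y \<union> ?Z")
  proof (intro equalityI subsetI)
    fix A assume A: "A \<in> ?X"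
    show "A \<in> ?Y \<union> ?Z"
    proof (cases "Suc L \<in> A")
      case True
      then have "A - {Suc L} \<in> S" using A by (auto simp: S_def lessThan_Suc)
      then show ?thesis using True by (auto intro!: image_eqI[of _ _ "A - {Suc L}"])
    next
      case False
      then show ?thesis using A by (auto simp: lessThan_Suc)
    qed
  next
    fix A assume "A \<in> ?Y \<union> ?Z"
    then show "A \<in> ?X"
    proof
      assume "A \<in> ?Y"
      then show ?thesis by (auto simp: lessThan_Suc)
    next
      assume "A \<in> ?Z"
      then obtain B where B: "B \<in> S" "A = insert (Suc L) B" by blast
      then have "finite B" using fin by (auto simp: S_def)
      then show ?thesis using B notin[of B] by (auto simp: S_def lessThan_Suc)
    qed
  qed
  have inj: "inj_on (insert (Suc L)) S"
    using notin by (metis inj_onI insert_ident)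
  have disj: "?Y \<inter> ?Z = {}" by auto
  have f_insert: "f (Suc b) (insert (Suc L) A) =
      Q ^ Suc a * f b A + (if L \<in> A then 0 else (y - 1) * Q ^ Suc a * f b A)" if A: "A \<in> S" for A
  proof -
    have sub: "A \<subseteq> {..<Suc L}" and card: "card A = b" using A by (auto simp: S_def)
    have le: "\<Sum>{..<b} \<le> \<Sum>A" using sum_card_le[of A] fin[OF sub] card by simp
    have "\<Sum>(insert (Suc L) A) = Suc L + \<Sum>A" using notin[OF A] fin[OF sub] by simp
    then have "\<Sum>(insert (Suc L) A) - \<Sum>{..<Suc b} = Suc a + (\<Sum>A - \<Sum>{..<b})"
      using le by (simp add: L_def)
    then show ?thesis
      by (simp add: f_def ascents_insert[OF sub] power_add algebra_simps)
  qed
  have S_not: "S \<inter> {A. L \<notin> A} = {A. A \<subseteq> {..<L} \<and> card A = b}"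
    by (auto simp: S_def lessThan_Suc)
  have "ascent_gf y Q (Suc a) (Suc b) = sum (f (Suc b)) (?Y \<union> ?Z)"
  proof -
    have "{A. A \<subseteq> {..<Suc a + Suc b} \<and> card A = Suc b} = ?Y \<union> ?Z"
      using split by (simp add: L_def)
    then show ?thesis by (simp only: ascent_gf_def f_def[abs_def])
  qed
  also have "\<dots> = sum (f (Suc b)) ?Y + sum (f (Suc b)) ?Z"
    by (rule sum.union_disjoint) (use finS disj in \<open>auto simp: S_def\<close>)
  also have "sum (f (Suc b)) ?Z = (\<Sum>A\<in>S. Q ^ Suc a * f b A
      + (if L \<notin> A then (y - 1) * Q ^ Suc a * f b A else 0))"
    by (subst sum.reindex[OF inj], rule sum.cong) (auto simp: f_insert)
  also have "\<dots> = Q ^ Suc a * sum (f b) S + (y - 1) * Q ^ Suc a * sum (f b) (S \<inter> {A. L \<notin> A})"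
  proof -
    have "finite S" using finS by (simp add: S_def)
    then show ?thesis
      by (simp only: sum.distrib sum_distrib_left sum.inter_restrict mem_Collect_eq) 
        (simp add: if_distrib cong: if_cong)
  qed
  finally show ?thesis
    by (simp add: ascent_gf_def f_def S_not) (simp add: S_def f_def L_def)
qed

section \<open>Congruences as divisibility of differences\<close>

lemma dvd_diff_mult_trans:
  fixes a b c d :: "'a::comm_ring_1"
  assumes "m dvd a - b" and "m dvd c - d"
  shows "m dvd a * c - b * d"
proof -
  have "a * c - b * d = (a - b) * c + b * (c - d)" by (simp add: algebra_simps)
  then show ?thesis using assms by simp
qed

text \<open>For \<open>b \<longrightarrow> \<infinity>\<close> the recurrence \<open>ascent_gf_Suc\<close> becomes
  \<open>(1 - Q\<^sup>a) g\<^sub>a = (1 + (y - 1) Q\<^sup>a) g\<^sub>a\<^sub>-\<^sub>1\<close>; the congruence is its truncated, division-free form.\<close>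

lemma ascent_gf_cong:
  fixes y Q :: "'a::comm_ring_1"
  shows "Q ^ Suc b dvd (\<Prod>k<a. 1 - Q ^ Suc k) * ascent_gf y Q a b - (\<Prod>k<a. 1 + (y - 1) * Q ^ Suc k)"
proof (induction a arbitrary: b)
  case 0
  then show ?case by (simp add: ascent_gf_0_left)
next
  case (Suc a)
  note IH = Suc.IH
  define P where "P a = (\<Prod>k<a. 1 - Q ^ Suc k)" for a
  define W where "W a = (\<Prod>k<a. 1 + (y - 1) * Q ^ Suc k)" for a
  have PS: "P (Suc a) = P a * (1 - Q ^ Suc a)" and WS: "W (Suc a) = W a * (1 + (y - 1) * Q ^ Suc a)"
    by (simp_all add: P_def W_def)
  have "Q ^ Suc b dvd P (Suc a) * ascent_gf y Q (Suc a) b - W (Suc a)"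
  proof (induction b)
    case 0
    have "Q dvd (1 - Q ^ Suc k) - 1" "Q dvd 1 + (y - 1) * Q ^ Suc k - 1" for k by simp_all
    then have "Q dvd P a - 1" "Q dvd W a - 1" for a
    proof (induction a)
      case 0
      { case 1 show ?case by (simp add: P_def) }
      { case 2 show ?case by (simp add: W_def) }
    next
      case (Suc a)
      { case 1 then show ?case using dvd_diff_mult_trans[OF Suc(1)[OF 1] 1(1)[of a]] by (simp add: P_def) }
      { case 2 then show ?case using dvd_diff_mult_trans[OF Suc(2)[OF 2] 2(2)[of a]] by (simp add: W_def) }
    qed
    then have "Q dvd (P (Suc a) - 1) - (W (Suc a) - 1)" by (rule dvd_diff)
    then show ?case by (simp add: ascent_gf_0_right)
  next
    case (Suc b)
    have 1: "Q ^ Suc (Suc b) dvd P a * ascent_gf y Q a (Suc b) - W a"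
      using IH[of "Suc b"] by (simp only: P_def W_def)
    \<comment> \<open>The factor \<open>Q ^ Suc a\<close> supplies the one power of \<open>Q\<close>
      that the hypotheses at \<open>b\<close> lack.\<close>
    have 2: "Q ^ Suc (Suc b) dvd Q ^ Suc a * (P (Suc a) * ascent_gf y Q (Suc a) b - W (Suc a))"
      using mult_dvd_mono[OF dvd_power_le[of Q Q 1 "Suc a"] Suc] by simp
    have 3: "Q ^ Suc (Suc b) dvd Q ^ Suc a * (P a * ascent_gf y Q a b - W a)"
      using mult_dvd_mono[OF dvd_power_le[of Q Q 1 "Suc a"] IH[of b]] by (simp add: P_def W_def)
    have "P (Suc a) * ascent_gf y Q (Suc a) (Suc b) - W (Suc a) =
       (1 - Q ^ Suc a) * (P a * ascent_gf y Q a (Suc b) - W a)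
       + Q ^ Suc a * (P (Suc a) * ascent_gf y Q (Suc a) b - W (Suc a))
       + (y - 1) * (1 - Q ^ Suc a) * (Q ^ Suc a * (P a * ascent_gf y Q a b - W a))"
      by (simp only: ascent_gf_Suc PS WS) (simp add: algebra_simps del: power_Suc)
    then show ?case using 1 2 3 by (metis dvd_add dvd_mult)
  qed
  then show ?case by (simp only: P_def W_def)
qed

text \<open>As long as \<open>Suc m \<le> n\<close>, if \<open>Q ^ m\<close> divides
  \<open>h\<close>, then \<open>Q ^ Suc m\<close> divides both \<open>(1 - u) * h\<close> and
  \<open>u * h\<close>, hence their sum. So \<open>u\<close> cancels without being inverted.\<close>

lemma dvd_mult_unit_cancel:
  fixes Q u h :: "'a::comm_ring_1"
  assumes "Q dvd 1 - u" and "Q ^ n dvd u * h"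
  shows "Q ^ n dvd h"
proof -
  have "Q ^ m dvd h" if "m \<le> n" for m
    using that
  proof (induction m)
    case (Suc m)
    have "Q ^ Suc m dvd (1 - u) * h"
      using mult_dvd_mono[OF assms(1), of "Q ^ m" h] Suc by simp
    moreover have "Q ^ Suc m dvd u * h"
      using assms(2) Suc.prems power_le_dvd by blast
    ultimately have "Q ^ Suc m dvd (1 - u) * h + u * h" by (rule dvd_add)
    then show ?case by (simp add: algebra_simps)
  qed simp
  then show ?thesis by simp
qed

lemma prod_one_plus_cong:
  fixes m :: "'a::comm_ring_1"
  assumes "finite B" and "A \<subseteq> B" and "\<And>k. k \<in> B - A \<Longrightarrow> m dvd f k - 1"
  shows "m dvd prod f B - prod f A"
proof -
  have "m dvd prod f C - 1" if "finite C" "C \<subseteq> B - A" for C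
    using that
  proof (induction C rule: finite_induct)
    case (insert x C)
    then show ?case using dvd_diff_mult_trans[OF assms(3)[of x], of "prod f C" 1] by simp
  qed simp
  from this[of "B - A"] have "m dvd prod f A * (prod f (B - A) - 1)" using assms(1) by simp
  also have "prod f A * (prod f (B - A) - 1) = prod f B - prod f A"
    using prod.subset_diff[OF assms(2,1), of f] by (simp add: algebra_simps)
  finally show ?thesis .
qed

text \<open>At \<open>y = 1\<close> the right-hand product of \<open>ascent_gf_cong\<close> is 1.
  Comparing the cases \<open>y\<close> and \<open>1\<close> leaves a factor \<open>P\<close> that is
  1 modulo \<open>Q\<close> and cancels. Extending the product from \<open>a\<close> to
  \<open>K\<close> factors is exact modulo \<open>Q ^ Suc a\<close>, hence the minimum; a common
  \<open>K\<close> serves all words at once.\<close>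

lemma ascent_gf_cong_1:
  fixes y Q :: "'a::comm_ring_1"
  assumes "a \<le> K"
  shows "Q ^ Suc (min a b) dvd
    ascent_gf y Q a b - (\<Prod>k<K. 1 + (y - 1) * Q ^ Suc k) * ascent_gf 1 Q a b"
proof -
  define P where "P = (\<Prod>k<a. 1 - Q ^ Suc k)"
  define W where "W n = (\<Prod>k<n. 1 + (y - 1) * Q ^ Suc k)" for n
  let ?m = "Q ^ Suc (min a b)"
  have m: "?m dvd Q ^ Suc b" by (intro le_imp_power_dvd) simp
  have 1: "?m dvd P * ascent_gf y Q a b - W a"
    using dvd_trans[OF m ascent_gf_cong[of Q b a y]] by (simp only: P_def W_def)
  have 2: "?m dvd P * ascent_gf 1 Q a b - 1"
    using dvd_trans[OF m ascent_gf_cong[of Q b a 1]] by (simp add: P_def)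
  have 3: "?m dvd W K - W a"
    unfolding W_def
  proof (rule prod_one_plus_cong)
    fix k assume "k \<in> {..<K} - {..<a}"
    then have "?m dvd Q ^ Suc k" by (intro le_imp_power_dvd) auto
    then show "?m dvd 1 + (y - 1) * Q ^ Suc k - 1" by (simp del: power_Suc)
  qed (use assms in auto)
  have "P * (ascent_gf y Q a b - W K * ascent_gf 1 Q a b)
     = (P * ascent_gf y Q a b - W a) - W K * (P * ascent_gf 1 Q a b - 1) - (W K - W a)"
    by (simp add: algebra_simps)
  then have *: "?m dvd P * (ascent_gf y Q a b - W K * ascent_gf 1 Q a b)"
    using 1 2 3 by (metis dvd_diff dvd_mult)
  have "Q dvd prod (\<lambda>k. 1 - Q ^ Suc k) {..<a} - prod (\<lambda>k. 1 - Q ^ Suc k) {}"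
    by (rule prod_one_plus_cong) auto
  then have "Q dvd - (P - 1)" unfolding dvd_minus_iff by (simp add: P_def)
  then have "Q dvd 1 - P" by simp
  from dvd_mult_unit_cancel[OF this *] show ?thesis by (simp only: W_def)
qed

subsection \<open>A single residue class\<close>

text \<open>This is \<open>\<bar>2k - 2N + 1\<bar>\<close>, the length of the diagonal hook encoded by \<open>k\<close> and its mirror image
  \<open>2N - 1 - k\<close>.\<close>

definition weight :: "nat \<Rightarrow> nat \<Rightarrow> nat" where
  "weight N k = (if N \<le> k then 2 * (k - N) + 1 else 2 * (N - 1 - k) + 1)"

text \<open>\<open>U\<close> is meant to hold one position of each mirrored pair. The condition says
  that the bead of the pair is its upper position, and then the pair encodes a diagonal
  hook.\<close>

definition set_weight :: "nat \<Rightarrow> nat set \<Rightarrow> nat set \<Rightarrow> nat" where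
  "set_weight N U Y = (\<Sum>k\<in>U. if (N \<le> k) = (k \<in> Y) then weight N k else 0)"

definition runner_weight :: "nat \<Rightarrow> nat \<Rightarrow> nat \<Rightarrow> nat set \<Rightarrow> nat" where
  "runner_weight t M r A = (\<Sum>i<2 * M. if (M \<le> i) = (i \<in> A) then weight (t * M) (r + t * i) else 0)"

definition runner_gf :: "nat \<Rightarrow> nat \<Rightarrow> nat \<Rightarrow> 'a::comm_ring_1 fps \<Rightarrow> 'a fps" where
  "runner_gf t M r y = (\<Sum>A\<in>Pow {..<2 * M}. y ^ ascents A * fps_X ^ runner_weight t M r A)"

lemma weight_pos: "1 \<le> weight N k"
  by (simp add: weight_def)

lemma runner_threshold:
  fixes t :: nat
  assumes "r < t"
  shows "t * M \<le> r + t * i \<longleftrightarrow> M \<le> i"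
proof
  assume "t * M \<le> r + t * i"
  then have "t * M < t * Suc i" using assms by simp
  then have "M < Suc i" by (simp only: mult_less_cancel1)
  then show "M \<le> i" by simp
next
  assume "M \<le> i"
  then have "t * M \<le> t * i" by (rule mult_le_mono2)
  then show "t * M \<le> r + t * i" by linarith
qed

text \<open>Let \<open>p i\<close> be the weight with a sign, negative below the middle. A bead
  above adds \<open>p i\<close> and a gap below adds \<open>- p i\<close>, so the total is the sum
  of \<open>p\<close> over \<open>A\<close> minus that over \<open>{..<M}\<close>. Since
  \<open>p\<close> is affine, only the size and the sum of \<open>A\<close> matter.\<close>

lemma int_runner_weight:
  assumes "r < t" and "A \<subseteq> {..<2 * M}"
  shows "int (runner_weight t M r A) = (2 * int r - 2 * int t * int M + 1) * int (card A)
    + 2 * int t * int (\<Sum>A) - (\<Sum>i<M. 2 * int (r + t * i) - 2 * int (t * M) + 1)"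
proof -
  define p where "p i = 2 * int (r + t * i) - 2 * int (t * M) + 1" for i
  have "int (if (M \<le> i) = (i \<in> A) then weight (t * M) (r + t * i) else 0) =
      (if i \<in> A then p i else 0) - (if i \<in> {..<M} then p i else 0)" for i
  proof (cases "M \<le> i")
    case True
    then have "int (weight (t * M) (r + t * i)) = p i"
      using runner_threshold[OF assms(1), of M i] by (simp add: weight_def p_def of_nat_diff)
    then show ?thesis using True by simp
  next
    case False
    then have "r + t * i < t * M"
      using runner_threshold[OF assms(1), of M i] by linarith
    then have "int (weight (t * M) (r + t * i)) = - p i"
      by (simp add: weight_def p_def of_nat_diff)
    then show ?thesis using False by simp
  qed
  then have "int (runner_weight t M r A) =
      (\<Sum>i<2 * M. if i \<in> A then p i else 0) - (\<Sum>i<2 * M. if i \<in> {..<M} then p i else 0)"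
    by (simp only: runner_weight_def of_nat_sum sum_subtractf)
  also have "(\<Sum>i<2 * M. if i \<in> A then p i else 0) = sum p A"
    by (subst sum.inter_restrict[symmetric]) (use assms(2) in \<open>auto simp: Int_absorb1\<close>)
  also have "(\<Sum>i<2 * M. if i \<in> {..<M} then p i else 0) = sum p {..<M}"
    by (subst sum.inter_restrict[symmetric]) (auto intro: sum.cong)
  also have "sum p A = (2 * int r - 2 * int t * int M + 1) * int (card A) + 2 * int t * int (\<Sum>A)"
  proof -
    have "sum p A = (\<Sum>i\<in>A. (2 * int r - 2 * int t * int M + 1) + 2 * int t * int i)"
      by (rule sum.cong) (auto simp: p_def algebra_simps)
    also have "\<dots> = (\<Sum>i\<in>A. (2 * int r - 2 * int t * int M + 1)) + 2 * int t * (\<Sum>i\<in>A. int i)"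
      by (simp only: sum.distrib sum_distrib_left)
    finally show ?thesis by (simp add: mult.commute)
  qed
  finally show ?thesis by (simp only: p_def)
qed

text \<open>For fixed size only the term with \<open>\<Sum>A\<close> varies, so the weight is an
  inversion count with \<open>Q = fps_X ^ (2 * t)\<close>.\<close>

lemma runner_weight_eq:
  assumes "r < t" and "A \<subseteq> {..<2 * M}"
  shows "runner_weight t M r A =
    runner_weight t M r {..<card A} + 2 * t * (\<Sum>A - \<Sum>{..<card A})"
proof -
  have fin: "finite A" using assms(2) finite_subset by blast
  have "card A \<le> 2 * M" using card_mono[OF _ assms(2)] by simp
  then have sub: "{..<card A} \<subseteq> {..<2 * M}" by auto
  have "\<Sum>{..<card A} \<le> \<Sum>A" by (rule sum_card_le[OF fin])
  then have "int (runner_weight t M r A) =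
      int (runner_weight t M r {..<card A} + 2 * t * (\<Sum>A - \<Sum>{..<card A}))"
    using int_runner_weight[OF assms] int_runner_weight[OF assms(1) sub]
    by (simp add: of_nat_diff right_diff_distrib)
  then show ?thesis by (simp only: of_nat_eq_iff)
qed

text \<open>Words with few zeros or few ones satisfy only a weak congruence in
  \<open>ascent_gf_cong_1\<close>, but carry a large minimal weight: \<open>{..<j}\<close> differs
  from \<open>{..<M}\<close> in |j - M| places, each of weight at least 1. The two effects add up to
  \<open>M\<close>.\<close>

lemma runner_weight_lower:
  assumes "j \<le> 2 * M"
  shows "M \<le> runner_weight t M r {..<j} + min (2 * M - j) j"
proof -
  let ?S = "{M..<j} \<union> {j..<M}"
  have card: "card ?S = (j - M) + (M - j)" by (subst card_Un_disjoint) auto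
  have "card ?S \<le> (\<Sum>i\<in>?S. weight (t * M) (r + t * i))"
    using sum_mono[of ?S "\<lambda>_. 1" "\<lambda>i. weight (t * M) (r + t * i)"] weight_pos by simp
  also have "\<dots> = (\<Sum>i\<in>?S. if (M \<le> i) = (i \<in> {..<j}) then weight (t * M) (r + t * i) else 0)"
    by (rule sum.cong) auto
  also have "\<dots> \<le> runner_weight t M r {..<j}"
    unfolding runner_weight_def by (rule sum_mono2) (use assms in auto)
  finally show ?thesis using assms card by linarith
qed

text \<open>Group by the number \<open>j\<close> of beads: these are the words with
  \<open>2 * M - j\<close> zeros, and \<open>{..<j}\<close> carries the minimal weight.\<close>

lemma runner_gf_eq:
  assumes "r < t"
  shows "runner_gf t M r y = (\<Sum>j\<le>2 * M. fps_X ^ runner_weight t M r {..<j} *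
    ascent_gf y (fps_X ^ (2 * t)) (2 * M - j) j)"
proof -
  let ?f = "\<lambda>A. y ^ ascents A * fps_X ^ runner_weight t M r A"
  have card_le: "card A \<le> 2 * M" if "A \<subseteq> {..<2 * M}" for A
    using card_mono[OF _ that] by simp
  have "runner_gf t M r y = (\<Sum>j\<le>2 * M. sum ?f {A \<in> Pow {..<2 * M}. card A = j})"
    unfolding runner_gf_def by (rule sum.group[symmetric]) (use card_le in auto)
  also have "\<dots> = (\<Sum>j\<le>2 * M. fps_X ^ runner_weight t M r {..<j} *
      ascent_gf y (fps_X ^ (2 * t)) (2 * M - j) j)"
  proof (rule sum.cong[OF refl])
    fix j assume "j \<in> {..2 * M}"
    then have *: "2 * M - j + j = 2 * M" by simp
    show "sum ?f {A \<in> Pow {..<2 * M}. card A = j} = fps_X ^ runner_weight t M r {..<j} *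
        ascent_gf y (fps_X ^ (2 * t)) (2 * M - j) j"
      unfolding ascent_gf_def sum_distrib_left *
    proof (rule sum.cong)
      fix A assume A: "A \<in> {A. A \<subseteq> {..<2 * M} \<and> card A = j}"
      then have "runner_weight t M r A = runner_weight t M r {..<j} + 2 * t * (\<Sum>A - \<Sum>{..<j})"
        using runner_weight_eq[OF assms, of A M] by auto
      then show "?f A = fps_X ^ runner_weight t M r {..<j} *
          (y ^ ascents A * (fps_X ^ (2 * t)) ^ (\<Sum>A - \<Sum>{..<j}))"
        by (simp only: power_add power_mult[symmetric] mult.assoc mult.left_commute)
    qed simp
  qed
  finally show ?thesis .
qed

lemma runner_gf_cong:
  assumes "r < t"
  shows "fps_X ^ M dvd runner_gf t M r y
    - (\<Prod>k<2 * M. 1 + (y - 1) * (fps_X ^ (2 * t)) ^ Suc k) * runner_gf t M r 1"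
proof -
  define W where "W = (\<Prod>k<2 * M. 1 + (y - 1) * (fps_X ^ (2 * t)) ^ Suc k)"
  let ?g = "\<lambda>y j. ascent_gf y (fps_X ^ (2 * t)) (2 * M - j) j"
  have "fps_X ^ M dvd fps_X ^ runner_weight t M r {..<j} * (?g y j - W * ?g 1 j)"
    if "j \<le> 2 * M" for j
  proof -
    have "M \<le> runner_weight t M r {..<j} + min (2 * M - j) j"
      by (rule runner_weight_lower[OF that])
    also have "\<dots> \<le> runner_weight t M r {..<j} + (2 * t) * Suc (min (2 * M - j) j)"
      using assms by (intro add_left_mono) (cases t; simp)
    finally have "fps_X ^ M dvd (fps_X ^ runner_weight t M r {..<j} * (fps_X ^ (2 * t)) ^ Suc (min (2 * M - j) j) :: 'a fps)"
      unfolding power_mult[symmetric] power_add[symmetric] by (rule le_imp_power_dvd)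
    also have "\<dots> dvd fps_X ^ runner_weight t M r {..<j} * (?g y j - W * ?g 1 j)"
      unfolding W_def by (intro mult_dvd_mono ascent_gf_cong_1 dvd_refl) simp
    finally show ?thesis .
  qed
  then have "fps_X ^ M dvd (\<Sum>j\<le>2 * M. fps_X ^ runner_weight t M r {..<j} * (?g y j - W * ?g 1 j))"
    by (intro dvd_sum) simp
  also have "\<dots> = runner_gf t M r y - W * runner_gf t M r 1"
    unfolding runner_gf_eq[OF assms] right_diff_distrib sum_subtractf sum_distrib_left
    by (simp only: mult.left_commute)
  finally show ?thesis by (simp only: W_def)
qed

subsection \<open>Partitions as bead sets\<close>

text \<open>Row lengths \<open>l\<close> and column lengths \<open>c\<close> of a diagram inside the \<open>N \<times> N\<close> box. Reading its
  boundary as a word of length \<open>2N\<close>, the rows sit at the beads and the columns at the gaps.\<close>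

locale conjugate_pair =
  fixes l c :: "nat \<Rightarrow> nat" and N :: nat
  assumes galois: "j < l i \<longleftrightarrow> i < c j" and l_le: "l i \<le> N" and c_le: "c j \<le> N"
begin

text \<open>Beta-numbers of the partition padded with empty rows to \<open>N\<close> rows, and the
  analogous places of the columns.\<close>

definition bead :: "nat \<Rightarrow> nat" where "bead i = l i + (N - 1 - i)"
definition gap :: "nat \<Rightarrow> nat" where "gap j = N + j - c j"
definition beads :: "nat set" where "beads = bead ` {..<N}"

lemma l_antimono: "i \<le> i' \<Longrightarrow> l i' \<le> l i"
  by (metis galois leI le_less_trans less_irrefl)

lemma l_eq_0: "N \<le> i \<Longrightarrow> l i = 0"
  using galois[of 0 i] c_le[of 0] by linarith

lemma bead_strict: "i < i' \<Longrightarrow> i' < N \<Longrightarrow> bead i' < bead i"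
  using l_antimono[of i i'] by (simp add: bead_def)

lemma c_antimono: "j \<le> j' \<Longrightarrow> c j' \<le> c j"
  by (metis galois leI le_less_trans less_irrefl)

lemma gap_strict: "j < j' \<Longrightarrow> gap j < gap j'"
  using c_antimono[of j j'] c_le[of j] c_le[of j'] by (simp add: gap_def)

lemma bead_inj: "inj_on bead {..<N}"
  by (rule inj_onI) (metis bead_strict lessThan_iff linorder_neqE_nat less_irrefl)

lemma gap_inj: "inj_on gap {..<N}"
  by (rule inj_onI) (metis gap_strict linorder_neqE_nat less_irrefl)

lemma bead_less: "i < N \<Longrightarrow> bead i < 2 * N"
  using l_le[of i] by (simp add: bead_def)

lemma gap_less: "j < N \<Longrightarrow> gap j < 2 * N"
  by (simp add: gap_def)

text \<open>Arm plus leg plus 1 is \<open>l i + c j - i - j - 1\<close>, which is also the distance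
  between the two places since \<open>N\<close> cancels.\<close>

lemma bead_minus_gap: "j < l i \<Longrightarrow> bead i = gap j + ((l i - j - 1) + (c j - i - 1) + 1)"
  using galois[of j i] c_le[of j] by (auto simp: bead_def gap_def)

lemma bead_less_gap:
  assumes "i < N" and "\<not> j < l i"
  shows "bead i < gap j"
  using assms galois[of j i] c_le[of j] by (auto simp: bead_def gap_def)

lemma card_beads: "card beads = N"
  using bead_inj by (simp add: beads_def card_image)

lemma beads_subset: "beads \<subseteq> {..<2 * N}"
  using bead_less by (auto simp: beads_def)

text \<open>Inside the diagram the bead lies above the gap, outside it below, so they never
  coincide; \<open>N\<close> of each fill the \<open>2 * N\<close> places.\<close>

lemma gaps_eq: "gap ` {..<N} = {..<2 * N} - beads"
proof (rule card_subset_eq)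
  show "gap ` {..<N} \<subseteq> {..<2 * N} - beads"
  proof (rule image_subsetI)
    fix j assume j: "j \<in> {..<N}"
    have "gap j \<noteq> bead i" if "i < N" for i
      using that bead_minus_gap[of j i] bead_less_gap[of i j] by (cases "j < l i") auto
    then have "gap j \<notin> beads" by (auto simp: beads_def)
    then show "gap j \<in> {..<2 * N} - beads" using gap_less j by simp
  qed
  show "card (gap ` {..<N}) = card ({..<2 * N} - beads)"
    using beads_subset card_beads gap_inj by (simp add: card_image card_Diff_subset finite_subset)
qed simp

lemma sum_beads: "\<Sum>beads = (\<Sum>i<N. l i) + \<Sum>{..<N}"
proof -
  have "\<Sum>beads = (\<Sum>i<N. bead i)"
    unfolding beads_def by (subst sum.reindex[OF bead_inj]) simp
  also have "\<dots> = (\<Sum>i<N. l i) + (\<Sum>i<N. N - Suc i)"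
    unfolding sum.distrib[symmetric] by (rule sum.cong) (auto simp: bead_def)
  finally show ?thesis using sum.nat_diff_reindex[of "\<lambda>i. i" N] by simp
qed

text \<open>The bead determines the row of the cell, and the gap \<open>t\<close> places below it
  determines the column.\<close>

lemma card_hooks:
  assumes "0 < t"
  shows "card {(i, j). j < l i \<and> (l i - j - 1) + (c j - i - 1) + 1 = t}
    = card {k \<in> beads. t \<le> k \<and> k - t \<notin> beads}" (is "card ?H = card ?K")
proof (rule bij_betw_same_card[of "\<lambda>(i, j). bead i"])
  have box: "i < N" "j < N" if "j < l i" for i j
    using that galois[of j i] l_le[of i] c_le[of j] by linarith+
  show "bij_betw (\<lambda>(i, j). bead i) ?H ?K"
    unfolding bij_betw_def
  proof (intro conjI inj_onI equalityI subsetI)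
    fix p p' assume p: "p \<in> ?H" "p' \<in> ?H" and eq: "(case p of (i, j) \<Rightarrow> bead i) = (case p' of (i, j) \<Rightarrow> bead i)"
    obtain i j i' j' where pp: "p = (i, j)" "p' = (i', j')" by (metis surj_pair)
    have h: "j < l i" "j' < l i'" and t: "(l i - j - 1) + (c j - i - 1) + 1 = t"
      "(l i' - j' - 1) + (c j' - i' - 1) + 1 = t" using p by (simp_all only: pp mem_Collect_eq prod.case)
    have h': "bead i = gap j + t" "bead i' = gap j' + t"
      using bead_minus_gap[OF h(1)] bead_minus_gap[OF h(2)] unfolding t .
    have "i = i'" using inj_onD[OF bead_inj] eq box[OF h(1)] box[OF h(2)] by (auto simp: pp)
    moreover have "gap j = gap j'" using eq h' by (simp add: pp)
    then have "j = j'" using inj_onD[OF gap_inj] box[OF h(1)] box[OF h(2)] by auto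
    ultimately show "p = p'" by (simp add: pp)
  next
    fix k assume "k \<in> (\<lambda>(i, j). bead i) ` ?H"
    then obtain i j where ij: "j < l i" "(l i - j - 1) + (c j - i - 1) + 1 = t" "k = bead i" by auto
    have "k = gap j + t" using bead_minus_gap[OF ij(1)] ij by simp
    moreover have "gap j \<notin> beads" using gaps_eq box[OF ij(1)] by blast
    moreover have "k \<in> beads" using box(1)[OF ij(1)] by (simp add: beads_def ij(3))
    ultimately show "k \<in> ?K" by simp
  next
    fix k assume k: "k \<in> ?K"
    then obtain i where i: "i < N" "k = bead i" by (auto simp: beads_def)
    have "k - t \<in> gap ` {..<N}" using k beads_subset gaps_eq by auto
    then obtain j where j: "j < N" "k - t = gap j" by auto
    have "j < l i" using bead_less_gap[OF i(1), of j] i j k assms by (cases "j < l i") auto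
    moreover have "(l i - j - 1) + (c j - i - 1) + 1 = t"
    proof -
      have "bead i = gap j + t" using i j k by auto
      then show ?thesis using bead_minus_gap[OF \<open>j < l i\<close>] by (metis add_left_cancel)
    qed
    ultimately have "(i, j) \<in> ?H" by blast
    then show "k \<in> (\<lambda>(i, j). bead i) ` ?H" using i(2) by (intro image_eqI[of _ _ "(i, j)"]) auto
  qed
qed

end

text \<open>One position from each mirrored pair. Such sets serve both as bead sets \<open>T\<close>
  of self-conjugate partitions and as sets \<open>U\<close> of representatives of the pairs.\<close>

definition antisymmetric_sets :: "nat \<Rightarrow> nat set set" where
  "antisymmetric_sets N = {T. T \<subseteq> {..<2 * N} \<and> (\<forall>k<2 * N. 2 * N - 1 - k \<in> T \<longleftrightarrow> k \<notin> T)}"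

text \<open>Stated outside the locale so that it applies to a row function before its column
  function is known.\<close>

definition bead_set :: "nat \<Rightarrow> (nat \<Rightarrow> nat) \<Rightarrow> nat set" where
  "bead_set N f = (\<lambda>i. f i + (N - 1 - i)) ` {..<N}"

text \<open>The shift by \<open>N - 1 - i\<close> turns weak decrease into strict decrease, so the
  bead set determines its row function on \<open>{..<N}\<close>.\<close>

lemma bead_set_sorted:
  assumes "\<And>i j. i \<le> j \<Longrightarrow> f j \<le> f i"
  shows "sorted_list_of_set (bead_set N f) = rev (map (\<lambda>i. f i + (N - 1 - i)) [0..<N])"
proof (rule sorted_list_of_set_unique[THEN iffD1])
  show "finite (bead_set N f)" by (simp add: bead_set_def)
  let ?h = "\<lambda>i. f i + (N - 1 - i)"
  have "f j + (N - 1 - j) < f i + (N - 1 - i)" if "i < j" "j < N" for i j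
    using assms[of i j] that by auto
  note strict = this
  then have "inj_on ?h {..<N}"
    by (intro inj_onI) (metis lessThan_iff linorder_neqE_nat less_irrefl)
  then have "card (bead_set N f) = N" by (simp only: bead_set_def card_image card_lessThan)
  moreover have "sorted_wrt (<) (rev (map ?h [0..<N]))"
    unfolding sorted_wrt_rev sorted_wrt_map
  proof (subst sorted_wrt_iff_nth_less, intro allI impI)
    fix i j assume ij: "i < j" "j < length [0..<N]"
    then have nth: "[0..<N] ! i = i" "[0..<N] ! j = j" by auto
    show "?h ([0..<N] ! j) < ?h ([0..<N] ! i)"
      unfolding nth by (rule strict) (use ij in auto)
  qed
  moreover have "set (rev (map ?h [0..<N])) = bead_set N f"
    by (simp only: set_rev set_map bead_set_def atLeast_upt)
  ultimately show "sorted_wrt (<) (rev (map ?h [0..<N])) \<and>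
      set (rev (map ?h [0..<N])) = bead_set N f \<and>
      length (rev (map ?h [0..<N])) = card (bead_set N f)"
    by simp
qed

lemma bead_set_inject:
  assumes "\<And>i j. i \<le> j \<Longrightarrow> f j \<le> f i" and "\<And>i j. i \<le> j \<Longrightarrow> g j \<le> g i"
    and "bead_set N f = bead_set N g" and "i < N"
  shows "f i = g i"
proof -
  have "map (\<lambda>i. f i + (N - 1 - i)) [0..<N] = map (\<lambda>i. g i + (N - 1 - i)) [0..<N]"
    using bead_set_sorted[of f N, OF assms(1)] bead_set_sorted[of g N, OF assms(2)] assms(3)
    by (metis rev_is_rev_conv)
  then have "\<forall>i\<in>set [0..<N]. f i + (N - 1 - i) = g i + (N - 1 - i)"
    by (simp only: map_eq_conv)
  from bspec[OF this, of i] show ?thesis using assms(4) by simp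
qed

text \<open>A strictly increasing list of naturals grows by at least 1 per step, so subtracting the
  rank from each entry keeps it weakly increasing; reading backwards gives the rows.\<close>

lemma bead_set_surj:
  assumes "finite T" and "card T = N"
  obtains f where "\<And>i j. i \<le> j \<Longrightarrow> f j \<le> f i" and "\<And>i. N \<le> i \<Longrightarrow> f i = 0" and "bead_set N f = T"
proof -
  define xs where "xs = sorted_list_of_set T"
  have len: "length xs = N" and set: "set xs = T" and srt: "sorted_wrt (<) xs"
    using assms by (simp_all add: xs_def)
  have step: "xs ! m + d \<le> xs ! (m + d)" if "m + d < N" for m d
    using that
  proof (induction d)
    case (Suc d)
    have "xs ! (m + d) < xs ! (m + Suc d)"
      using srt Suc.prems len by (simp add: sorted_wrt_nth_less)
    then show ?case using Suc by simp
  qed simp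
  define f where "f i = (if i < N then xs ! (N - 1 - i) - (N - 1 - i) else 0)" for i
  show thesis
  proof (rule that[of f])
    fix i j :: nat assume "i \<le> j"
    then show "f j \<le> f i"
      using step[of "N - 1 - j" "j - i"] by (auto simp: f_def)
  next
    show "f i = 0" if "N \<le> i" for i using that by (simp add: f_def)
  next
    have "f i + (N - 1 - i) = xs ! (N - 1 - i)" if "i < N" for i
      using step[of 0 "N - 1 - i"] that by (simp add: f_def)
    then have "bead_set N f = (\<lambda>i. xs ! (N - 1 - i)) ` {..<N}"
      by (simp add: bead_set_def)
    also have "\<dots> = (!) xs ` ((\<lambda>i. N - 1 - i) ` {..<N})" by (simp add: image_image)
    also have "(\<lambda>i. N - 1 - i) ` {..<N} = {..<N}"
      by (auto intro: image_eqI[of k _ "N - 1 - k" for k])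
    also have "(!) xs ` {..<N} = T" using len set by (auto simp: set_conv_nth)
    finally show "bead_set N f = T" .
  qed
qed

text \<open>The mirror exchanges \<open>T\<close> with its complement in
  \<open>{..<2 * N}\<close>.\<close>

lemma antisymmetric_sets_card:
  assumes "T \<in> antisymmetric_sets N"
  shows "card T = N"
proof -
  have T: "T \<subseteq> {..<2 * N}" "\<And>k. k < 2 * N \<Longrightarrow> 2 * N - 1 - k \<in> T \<longleftrightarrow> k \<notin> T"
    using assms by (auto simp: antisymmetric_sets_def)
  have fin: "finite T" using T finite_subset by blast
  have "bij_betw (\<lambda>k. 2 * N - 1 - k) T ({..<2 * N} - T)"
  proof (rule bij_betw_byWitness[of _ "\<lambda>k. 2 * N - 1 - k"])
    have "2 * N - 1 - k < 2 * N \<and> 2 * N - 1 - k \<notin> T" if "k \<in> T" for k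
      using T(2)[of k] that T(1) by auto
    then show "(\<lambda>k. 2 * N - 1 - k) ` T \<subseteq> {..<2 * N} - T" by blast
    show "(\<lambda>k. 2 * N - 1 - k) ` ({..<2 * N} - T) \<subseteq> T" using T(2) by blast
  qed (use T(1) in auto)
  then have "card T = card ({..<2 * N} - T)" by (rule bij_betw_same_card)
  also have "\<dots> = 2 * N - card T" using T fin by (simp add: card_Diff_subset)
  finally show ?thesis by simp
qed

section \<open>Partitions as lists: column lengths and conjugation\<close>

definition col :: "nat list \<Rightarrow> nat \<Rightarrow> nat" where
  "col lam j = length (filter (\<lambda>x. j < x) lam)"

text \<open>In a weakly decreasing list the entries exceeding \<open>j\<close> form a prefix, so
  counting them is the same as bounding their indices.\<close>

lemma col_galois:
  assumes "is_partition lam"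
  shows "j < nth_default 0 lam i \<longleftrightarrow> i < col lam j"
  using assms
proof (induction lam arbitrary: i)
  case Nil
  then show ?case by (simp add: col_def)
next
  case (Cons x lam)
  have "is_partition lam" and le: "\<forall>y\<in>set lam. y \<le> x"
    using Cons.prems by (simp_all add: is_partition_def)
  note IH = Cons.IH[OF this(1)]
  show ?case
  proof (cases "j < x")
    case True
    then show ?thesis by (cases i) (auto simp: IH col_def)
  next
    case False
    then have "\<And>y. y \<in> set lam \<Longrightarrow> \<not> j < y" using le by fastforce
    then have "col lam j = 0" by (simp add: col_def filter_empty_conv)
    then show ?thesis using False IH by (cases i) (auto simp: col_def)
  qed
qed

lemma nth_default_conj_part:
  assumes "is_partition lam"
  shows "nth_default 0 (conj_part lam) j = col lam j"
proof (cases "j < nth_default 0 lam 0")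
  case True
  then show ?thesis
    by (cases lam) (auto simp: conj_part_def nth_default_def col_def)
next
  case False
  then have "col lam j = 0" using col_galois[OF assms, of j 0] by simp
  then show ?thesis using False
    by (cases lam) (auto simp: conj_part_def nth_default_def)
qed

lemma conj_part_pos:
  assumes "is_partition lam"
  shows "\<forall>x\<in>set (conj_part lam). 0 < x"
proof (cases lam)
  case (Cons a lam')
  then have "0 < col lam j" if "j < a" for j
    using that col_galois[OF assms, of j 0] by simp
  then show ?thesis using Cons by (auto simp: conj_part_def col_def)
qed (simp add: conj_part_def)

lemma partition_eqI:
  fixes lam mu :: "nat list"
  assumes "\<forall>x\<in>set lam. 0 < x" and "\<forall>x\<in>set mu. 0 < x"
    and "nth_default 0 lam = nth_default 0 mu"
  shows "lam = mu"
proof -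
  have pos: "0 < nth_default 0 xs i \<longleftrightarrow> i < length xs" if "\<forall>x\<in>set xs. 0 < (x :: nat)" for xs i
    using that by (auto simp: nth_default_def)
  have "length lam = length mu"
    using pos[OF assms(1)] pos[OF assms(2)] assms(3) by (metis linorder_neqE_nat less_irrefl)
  then show ?thesis using assms(3) by (metis nth_default_nth nth_equalityI)
qed

lemma partition_of_fun:
  assumes "\<And>i j. i \<le> j \<Longrightarrow> f j \<le> f i" and "\<And>i. N \<le> i \<Longrightarrow> f i = (0 :: nat)"
  obtains lam where "is_partition lam" and "nth_default 0 lam = f"
proof -
  define K where "K = (LEAST i. f i = 0)"
  have K: "f K = 0" unfolding K_def using assms(2)[of N] by (intro LeastI[of "\<lambda>i. f i = 0" N]) simp
  have pos: "0 < f i" if "i < K" for i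
    using not_less_Least that unfolding K_def by blast
  show thesis
  proof
    show "is_partition (map f [0..<K])"
      using assms(1) pos by (auto simp: is_partition_def sorted_wrt_iff_nth_less)
    show "nth_default 0 (map f [0..<K]) = f"
      using assms(1)[of K] K by (auto simp: nth_default_def fun_eq_iff)
  qed
qed

lemma psize_eq_sum:
  assumes "length lam \<le> N"
  shows "psize lam = (\<Sum>i<N. nth_default 0 lam i)"
proof -
  have "psize lam = (\<Sum>i<length lam. lam ! i)"
    by (simp add: psize_def sum_list_sum_nth atLeast0LessThan)
  also have "\<dots> = (\<Sum>i<length lam. nth_default 0 lam i)"
    by (simp add: nth_default_def)
  also have "\<dots> = (\<Sum>i<N. nth_default 0 lam i)"
    by (rule sum.mono_neutral_left) (use assms in \<open>auto simp: nth_default_def\<close>)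
  finally show ?thesis .
qed

section \<open>Self-conjugate partitions and antisymmetric sets\<close>

lemma self_conjugate_pair:
  assumes "self_conjugate lam" and "length lam \<le> N"
  shows "conjugate_pair (nth_default 0 lam) (nth_default 0 lam) N"
proof -
  have p: "is_partition lam" "conj_part lam = lam" using assms by (auto simp: self_conjugate_def)
  have eq: "col lam = nth_default 0 lam" using nth_default_conj_part[OF p(1)] p(2) by auto
  have "col lam j \<le> N" for j
    using assms(2) length_filter_le[of "\<lambda>x. j < x" lam] unfolding col_def by linarith
  then show ?thesis
    using col_galois[OF p(1)] by unfold_locales (simp_all add: eq)
qed

lemma (in conjugate_pair) beads_eq: "beads = bead_set N l"
  by (simp add: beads_def bead_set_def bead_def)

text \<open>The bead of column \<open>j\<close> in the conjugate is the mirror image of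
  \<open>gap j\<close>. Self-conjugacy thus becomes invariance under complement and mirror.\<close>

lemma (in conjugate_pair) bead_set_conj:
  "bead_set N c = (\<lambda>k. 2 * N - 1 - k) ` ({..<2 * N} - beads)"
proof -
  have "c j + (N - 1 - j) = 2 * N - 1 - gap j" if "j < N" for j
    using c_le[of j] that by (simp add: gap_def)
  then show ?thesis
    by (simp add: gaps_eq[symmetric] bead_set_def image_image)
qed

lemma antisymmetric_iff:
  assumes "T \<subseteq> {..<2 * N}"
  shows "T \<in> antisymmetric_sets N \<longleftrightarrow> (\<lambda>k. 2 * N - 1 - k) ` ({..<2 * N} - T) = T"
proof
  assume T: "T \<in> antisymmetric_sets N"
  have mirror: "\<And>k. k < 2 * N \<Longrightarrow> 2 * N - 1 - k \<in> T \<longleftrightarrow> k \<notin> T"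
    using T by (simp add: antisymmetric_sets_def)
  show "(\<lambda>k. 2 * N - 1 - k) ` ({..<2 * N} - T) = T"
  proof (intro equalityI subsetI)
    fix k assume k: "k \<in> T"
    then have "k < 2 * N" using assms by auto
    then show "k \<in> (\<lambda>k. 2 * N - 1 - k) ` ({..<2 * N} - T)"
      using mirror[of k] k by (intro image_eqI[of _ _ "2 * N - 1 - k"]) auto
  next
    fix k assume "k \<in> (\<lambda>k. 2 * N - 1 - k) ` ({..<2 * N} - T)"
    then show "k \<in> T" using mirror by blast
  qed
next
  assume eq: "(\<lambda>k. 2 * N - 1 - k) ` ({..<2 * N} - T) = T"
  have "2 * N - 1 - k \<in> T \<longleftrightarrow> k \<notin> T" if k: "k < 2 * N" for k
  proof
    assume "2 * N - 1 - k \<in> T"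
    then have "2 * N - 1 - k \<in> (\<lambda>k. 2 * N - 1 - k) ` ({..<2 * N} - T)" by (simp only: eq)
    then obtain k' where k': "k' < 2 * N" "k' \<notin> T" "2 * N - 1 - k = 2 * N - 1 - k'" by blast
    then have "k = k'" using k by linarith
    then show "k \<notin> T" using k' by simp
  next
    assume "k \<notin> T"
    then show "2 * N - 1 - k \<in> T" using eq k by blast
  qed
  then show "T \<in> antisymmetric_sets N" using assms by (simp add: antisymmetric_sets_def)
qed

lemma self_conjugate_bij:
  "bij_betw (\<lambda>lam. bead_set N (nth_default 0 lam)) {lam. self_conjugate lam \<and> length lam \<le> N}
    (antisymmetric_sets N)" (is "bij_betw ?b ?S _")
  unfolding bij_betw_def
proof (intro conjI inj_onI equalityI subsetI)
  fix lam mu assume lm: "lam \<in> ?S" "mu \<in> ?S" and eq: "?b lam = ?b mu"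
  interpret lam: conjugate_pair "nth_default 0 lam" "nth_default 0 lam" N
    using lm self_conjugate_pair by simp
  interpret mu: conjugate_pair "nth_default 0 mu" "nth_default 0 mu" N
    using lm self_conjugate_pair by simp
  have "nth_default 0 lam i = nth_default 0 mu i" for i
  proof (cases "i < N")
    case True
    then show ?thesis using bead_set_inject[OF lam.l_antimono mu.l_antimono eq] by blast
  next
    case False
    then show ?thesis using lam.l_eq_0 mu.l_eq_0 by simp
  qed
  then show "lam = mu"
    using lm by (intro partition_eqI) (auto simp: self_conjugate_def is_partition_def)
next
  fix T assume "T \<in> ?b ` ?S"
  then obtain lam where lam: "lam \<in> ?S" "T = ?b lam" by blast
  interpret conjugate_pair "nth_default 0 lam" "nth_default 0 lam" N
    using lam self_conjugate_pair by simp
  show "T \<in> antisymmetric_sets N"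
    unfolding lam(2) beads_eq[symmetric] antisymmetric_iff[OF beads_subset]
    by (rule bead_set_conj[folded beads_eq, symmetric])
next
  fix T assume T: "T \<in> antisymmetric_sets N"
  then have sub: "T \<subseteq> {..<2 * N}" by (simp add: antisymmetric_sets_def)
  then have "finite T" by (rule finite_subset) simp
  then obtain f where f: "\<And>i j. i \<le> j \<Longrightarrow> f j \<le> f i" "\<And>i. N \<le> i \<Longrightarrow> f i = 0" "bead_set N f = T"
    using bead_set_surj antisymmetric_sets_card[OF T] by metis
  obtain lam where lam: "is_partition lam" "nth_default 0 lam = f"
    by (rule partition_of_fun[of f N]) (use f(1,2) in blast)+
  have f_le: "f i \<le> N" for i
  proof (cases "N = 0")
    case True
    then show ?thesis using f(2) by simp
  next
    case False
    \<comment> \<open>The largest bead lies below \<open>2 * N\<close>, which bounds the first row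
      by \<open>N\<close>.\<close>
    then have "f 0 + (N - 1 - 0) \<in> T" using f(3) by (auto simp: bead_set_def)
    then have "f 0 + (N - 1) < 2 * N" using sub by auto
    then have "f 0 \<le> N" by simp
    then show ?thesis using f(1)[of 0 i] by simp
  qed
  have galois: "j < f i \<longleftrightarrow> i < col lam j" for i j using col_galois[OF lam(1)] lam(2) by metis
  interpret conjugate_pair f "col lam" N
  proof
    show "col lam j \<le> N" for j
      using galois[of j N] f(2)[of N] by simp
  qed (use galois f_le in auto)
  \<comment> \<open>Conjugating mirrors the complement of \<open>T\<close>, which is
    \<open>T\<close> again; equal bead sets then force \<open>col lam\<close> and \<open>f\<close>
    to agree below \<open>N\<close>.\<close>
  have eq: "bead_set N (col lam) = bead_set N f"
    using bead_set_conj antisymmetric_iff[OF sub] T by (simp add: beads_eq f(3))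
  have "col lam i = f i" for i
  proof (cases "i < N")
    case True
    then show ?thesis using bead_set_inject[OF c_antimono f(1) eq] by blast
  next
    case False
    then show ?thesis using f(2)[of i] galois[of i 0] f_le[of 0] by simp
  qed
  then have "nth_default 0 (conj_part lam) = nth_default 0 lam"
    using nth_default_conj_part[OF lam(1)] lam(2) by auto
  moreover have "\<forall>x\<in>set (conj_part lam). 0 < x"
    using conj_part_pos[OF lam(1)] .
  ultimately have "conj_part lam = lam"
    using lam(1) by (intro partition_eqI) (auto simp: is_partition_def)
  then have "self_conjugate lam" using lam by (simp add: self_conjugate_def)
  moreover have "length lam \<le> N"
  proof (rule ccontr)
    assume "\<not> length lam \<le> N"
    then have "lam ! N \<in> set lam" "nth_default 0 lam N = lam ! N" by (auto simp: nth_default_def)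
    then show False using lam f(2)[of N] by (auto simp: is_partition_def)
  qed
  ultimately show "T \<in> ?b ` ?S" using lam f(3) by (intro image_eqI[of _ _ lam]) simp_all
qed

subsection \<open>The product over residue classes\<close>

text \<open>For \<open>t = 2h\<close> and \<open>L = 2M\<close> these positions contain one element of each mirrored pair
  \<open>{k, 2N - 1 - k}\<close>, \<open>N = tM\<close>, and whole residue classes modulo \<open>t\<close>. This is where the parity of
  \<open>t\<close> enters: for odd \<open>t\<close> one residue class is its own mirror image.\<close>

definition positions :: "nat \<Rightarrow> nat \<Rightarrow> nat \<Rightarrow> nat set" where
  "positions t h L = (\<lambda>(r, i). r + t * i) ` ({..<h} \<times> {..<L})"

lemma runner_div_mod:
  fixes t :: nat
  assumes "r < t"
  shows "(r + t * i) mod t = r" and "(r + t * i) div t = i"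
  using assms by simp_all

lemma inj_runner:
  assumes "h \<le> (t :: nat)"
  shows "inj_on (\<lambda>(r, i). r + t * i) ({..<h} \<times> I)"
proof (rule inj_onI)
  fix p q assume pq: "p \<in> {..<h} \<times> I" "q \<in> {..<h} \<times> I"
    and eq: "(case p of (r, i) \<Rightarrow> r + t * i) = (case q of (r, i) \<Rightarrow> r + t * i)"
  obtain r i r' i' where p: "p = (r, i)" and q: "q = (r', i')" by (metis surj_pair)
  have "r < t" "r' < t" using pq assms by (auto simp: p q)
  moreover have "r + t * i = r' + t * i'" using eq by (simp add: p q)
  ultimately have "r = r'" "i = i'" by (metis runner_div_mod(1), metis runner_div_mod(2))
  then show "p = q" by (simp add: p q)
qed

lemma mem_positions:
  assumes "h \<le> t"
  shows "k \<in> positions t h L \<longleftrightarrow> k < t * L \<and> k mod t < h"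
proof
  assume "k \<in> positions t h L"
  then obtain r i where ri: "r < h" "i < L" "k = r + t * i" by (auto simp: positions_def)
  have "\<not> t * L \<le> r + t * i" using runner_threshold[of r t L i] ri assms by simp
  then show "k < t * L \<and> k mod t < h" using ri assms runner_div_mod[of r t i] by simp
next
  assume k: "k < t * L \<and> k mod t < h"
  then have "0 < t" by (cases t) auto
  then have "k div t < L" using k by (simp add: div_less_iff_less_mult mult.commute)
  moreover have "k = k mod t + t * (k div t)" by simp
  ultimately show "k \<in> positions t h L"
    unfolding positions_def using k by (intro image_eqI[of _ _ "(k mod t, k div t)"]) auto
qed

lemma runner_mem_positions:
  "r < h \<Longrightarrow> h \<le> t \<Longrightarrow> r + t * i \<in> positions t h L \<longleftrightarrow> i < L"
  using runner_threshold[of r t L i] runner_div_mod[of r t i] by (auto simp: mem_positions)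

lemma sum_positions:
  fixes f :: "nat \<Rightarrow> nat"
  assumes "h \<le> t"
  shows "(\<Sum>k\<in>positions t h L. f k) = (\<Sum>r<h. \<Sum>i<L. f (r + t * i))"
  unfolding positions_def sum.reindex[OF inj_runner[OF assms]]
  by (simp add: sum.cartesian_product o_def case_prod_unfold)

text \<open>A runner of the abacus: a move by \<open>t\<close> becomes a move by one place.\<close>

definition runner :: "nat \<Rightarrow> nat set \<Rightarrow> nat \<Rightarrow> nat set" where
  "runner t Y r = {i. r + t * i \<in> Y}"

text \<open>Extensional functions match the index set of \<open>prod_sum_PiE\<close>, which expands
  the product over the runners.\<close>

lemma runners_bij:
  assumes "h \<le> t"
  shows "bij_betw (\<lambda>Y. restrict (runner t Y) {..<h}) (Pow (positions t h L)) ({..<h} \<rightarrow>\<^sub>E Pow {..<L})"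
proof (rule bij_betw_byWitness[of _ "\<lambda>F. (\<lambda>(r, i). r + t * i) ` (SIGMA r:{..<h}. F r)"])
  have sub: "runner t Y r \<subseteq> {..<L}" if "Y \<subseteq> positions t h L" "r < h" for Y r
    using that runner_mem_positions[OF that(2) assms] by (auto simp: runner_def)
  then show "(\<lambda>Y. restrict (runner t Y) {..<h}) ` Pow (positions t h L) \<subseteq> {..<h} \<rightarrow>\<^sub>E Pow {..<L}"
    by (intro image_subsetI restrict_PiE_iff[THEN iffD2]) simp
  show "(\<lambda>F. (\<lambda>(r, i). r + t * i) ` (SIGMA r:{..<h}. F r)) ` ({..<h} \<rightarrow>\<^sub>E Pow {..<L}) \<subseteq> Pow (positions t h L)"
  proof (intro image_subsetI PowI)
    fix F k assume F: "F \<in> {..<h} \<rightarrow>\<^sub>E Pow {..<L}" and "k \<in> (SIGMA r:{..<h}. F r)"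
    then obtain r i where "k = (r, i)" "r < h" "i \<in> F r" by auto
    moreover have "F r \<subseteq> {..<L}" using PiE_mem[OF F, of r] \<open>r < h\<close> by simp
    ultimately show "(case k of (r, i) \<Rightarrow> r + t * i) \<in> positions t h L"
      using runner_mem_positions[OF \<open>r < h\<close> assms] by auto
  qed
  show "\<forall>Y\<in>Pow (positions t h L). (\<lambda>(r, i). r + t * i) ` (SIGMA r:{..<h}. restrict (runner t Y) {..<h} r) = Y"
  proof
    fix Y assume Y: "Y \<in> Pow (positions t h L)"
    show "(\<lambda>(r, i). r + t * i) ` (SIGMA r:{..<h}. restrict (runner t Y) {..<h} r) = Y"
    proof (intro equalityI subsetI)
      fix k assume "k \<in> (\<lambda>(r, i). r + t * i) ` (SIGMA r:{..<h}. restrict (runner t Y) {..<h} r)"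
      then show "k \<in> Y" by (auto simp: runner_def)
    next
      fix k assume k: "k \<in> Y"
      then have "k \<in> positions t h L" using Y by auto
      then obtain r i where "r < h" "k = r + t * i" by (auto simp: positions_def)
      then show "k \<in> (\<lambda>(r, i). r + t * i) ` (SIGMA r:{..<h}. restrict (runner t Y) {..<h} r)"
        using k by (intro image_eqI[of _ _ "(r, i)"]) (auto simp: runner_def)
    qed
  qed
  show "\<forall>F\<in>{..<h} \<rightarrow>\<^sub>E Pow {..<L}.
      restrict (runner t ((\<lambda>(r, i). r + t * i) ` (SIGMA r:{..<h}. F r))) {..<h} = F"
  proof
    fix F assume F: "F \<in> {..<h} \<rightarrow>\<^sub>E Pow {..<L}"
    show "restrict (runner t ((\<lambda>(r, i). r + t * i) ` (SIGMA r:{..<h}. F r))) {..<h} = F"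
    proof (rule extensionalityI[OF restrict_extensional])
      show "F \<in> extensional {..<h}" using F by (simp add: PiE_iff)
      fix r assume r: "r \<in> {..<h}"
      have "r + t * i \<in> (\<lambda>(r, i). r + t * i) ` (SIGMA r:{..<h}. F r) \<longleftrightarrow> i \<in> F r" for i
      proof
        assume "r + t * i \<in> (\<lambda>(r, i). r + t * i) ` (SIGMA r:{..<h}. F r)"
        then obtain r' i' where *: "r' < h" "i' \<in> F r'" "r + t * i = r' + t * i'" by auto
        moreover have "r < t" "r' < t" using r * assms by auto
        ultimately have "r = r'" "i = i'" by (metis runner_div_mod(1), metis runner_div_mod(2))
        then show "i \<in> F r" using * by simp
      next
        assume "i \<in> F r"
        then show "r + t * i \<in> (\<lambda>(r, i). r + t * i) ` (SIGMA r:{..<h}. F r)"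
          using r by (intro image_eqI[of _ _ "(r, i)"]) auto
      qed
      then show "restrict (runner t ((\<lambda>(r, i). r + t * i) ` (SIGMA r:{..<h}. F r))) {..<h} r = F r"
        using r by (simp add: runner_def)
    qed
  qed
qed

lemma sum_prod_runners:
  fixes f :: "nat \<Rightarrow> nat set \<Rightarrow> 'a::comm_semiring_1"
  assumes "h \<le> t"
  shows "(\<Sum>Y\<in>Pow (positions t h L). \<Prod>r<h. f r (runner t Y r)) = (\<Prod>r<h. \<Sum>A\<in>Pow {..<L}. f r A)"
proof -
  have "(\<Prod>r<h. \<Sum>A\<in>Pow {..<L}. f r A) = (\<Sum>F\<in>{..<h} \<rightarrow>\<^sub>E Pow {..<L}. \<Prod>r<h. f r (F r))"
    by (rule prod_sum_PiE) auto
  also have "\<dots> = (\<Sum>Y\<in>Pow (positions t h L). \<Prod>r<h. f r (restrict (runner t Y) {..<h} r))"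
    by (rule sum.reindex_bij_betw[OF runners_bij[OF assms], symmetric])
  finally show ?thesis by simp
qed

text \<open>A move by \<open>t\<close> preserves the residue, so it is an ascent of exactly one
  runner; \<open>t \<le> k\<close> turns into \<open>0 < i\<close>.\<close>

lemma card_runners:
  assumes "h \<le> t" and Y: "Y \<subseteq> positions t h L"
  shows "card {k \<in> Y. t \<le> k \<and> k - t \<notin> Y} = (\<Sum>r<h. ascents (runner t Y r))"
proof -
  define B where "B r = {i \<in> runner t Y r. 0 < i \<and> i - 1 \<notin> runner t Y r}" for r
  have step: "t \<le> r + t * i \<longleftrightarrow> 0 < i" "0 < i \<Longrightarrow> r + t * i - t = r + t * (i - 1)" if "r < h" for r i
    using that assms(1) by (cases i; simp)+
  have "{k \<in> Y. t \<le> k \<and> k - t \<notin> Y} = (\<lambda>(r, i). r + t * i) ` (SIGMA r:{..<h}. B r)"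
  proof (intro equalityI subsetI)
    fix k assume k: "k \<in> {k \<in> Y. t \<le> k \<and> k - t \<notin> Y}"
    then have "k \<in> positions t h L" using Y by auto
    then obtain r i where ri: "r < h" "k = r + t * i" by (auto simp: positions_def)
    then have "i \<in> B r" using k step[OF ri(1), of i] by (auto simp: B_def runner_def)
    then show "k \<in> (\<lambda>(r, i). r + t * i) ` (SIGMA r:{..<h}. B r)"
      using ri by (intro image_eqI[of _ _ "(r, i)"]) auto
  next
    fix k assume "k \<in> (\<lambda>(r, i). r + t * i) ` (SIGMA r:{..<h}. B r)"
    then obtain r i where ri: "r < h" "i \<in> B r" "k = r + t * i" by auto
    then show "k \<in> {k \<in> Y. t \<le> k \<and> k - t \<notin> Y}"
      using step[OF ri(1), of i] by (auto simp: B_def runner_def)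
  qed
  moreover have "inj_on (\<lambda>(r, i). r + t * i) (SIGMA r:{..<h}. B r)"
    by (rule inj_on_subset[OF inj_runner[OF assms(1), of UNIV]]) auto
  moreover have "finite (B r)" if "r < h" for r
  proof (rule finite_subset)
    show "B r \<subseteq> {..<L}"
      using Y runner_mem_positions[OF that assms(1)] by (auto simp: B_def runner_def)
  qed simp
  ultimately show ?thesis
    by (simp add: card_image card_SigmaI ascents_def B_def)
qed

lemma set_weight_runners:
  assumes "h \<le> t"
  shows "set_weight (t * M) (positions t h (2 * M)) Y = (\<Sum>r<h. runner_weight t M r (runner t Y r))"
  unfolding set_weight_def sum_positions[OF assms] runner_weight_def
  by (intro sum.cong refl) (use runner_threshold assms in \<open>auto simp: runner_def\<close>)

lemma sum_positions_eq_prod: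
  assumes "h \<le> t"
  shows "(\<Sum>Y\<in>Pow (positions t h (2 * M)). y ^ card {k \<in> Y. t \<le> k \<and> k - t \<notin> Y}
      * fps_X ^ set_weight (t * M) (positions t h (2 * M)) Y) = (\<Prod>r<h. runner_gf t M r y)"
  (is "?lhs = _")
proof -
  have "?lhs = (\<Sum>Y\<in>Pow (positions t h (2 * M)). \<Prod>r<h.
      y ^ ascents (runner t Y r) * fps_X ^ runner_weight t M r (runner t Y r))"
    by (rule sum.cong[OF refl])
      (simp add: card_runners[OF assms] set_weight_runners[OF assms] power_sum prod.distrib)
  also have "\<dots> = (\<Prod>r<h. runner_gf t M r y)"
    unfolding runner_gf_def by (rule sum_prod_runners[OF assms])
  finally show ?thesis .
qed

lemma prod_runner_gf_cong:
  assumes "h \<le> t"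
  shows "fps_X ^ M dvd (\<Prod>r<h. runner_gf t M r y)
    - (\<Prod>k<2 * M. 1 + (y - 1) * (fps_X ^ (2 * t)) ^ Suc k) ^ h * (\<Prod>r<h. runner_gf t M r 1)"
  using assms
proof (induction h)
  case (Suc h)
  have "fps_X ^ M dvd runner_gf t M h y
    - (\<Prod>k<2 * M. 1 + (y - 1) * (fps_X ^ (2 * t)) ^ Suc k) * runner_gf t M h 1"
    by (rule runner_gf_cong) (use Suc in simp)
  from dvd_diff_mult_trans[OF Suc.IH this] show ?case
    using Suc.prems by (simp add: ac_simps)
qed simp

subsection \<open>Self-conjugate bead sets\<close>

lemma antisymmetric_mirror:
  "U \<in> antisymmetric_sets N \<Longrightarrow> k < 2 * N \<Longrightarrow> 2 * N - 1 - k \<in> U \<longleftrightarrow> k \<notin> U"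
  by (simp add: antisymmetric_sets_def)

lemma antisymmetric_subset: "U \<in> antisymmetric_sets N \<Longrightarrow> U \<subseteq> {..<2 * N}"
  by (simp add: antisymmetric_sets_def)

text \<open>The mirror sends residue \<open>r\<close> to \<open>2 * h - 1 - r\<close>, and exactly
  one of these is below \<open>h\<close>.\<close>

lemma positions_antisymmetric: "positions (2 * h) h (2 * M) \<in> antisymmetric_sets (2 * h * M)"
proof -
  let ?t = "2 * h" and ?N = "2 * h * M"
  have "2 * ?N - 1 - k \<in> positions ?t h (2 * M) \<longleftrightarrow> k \<notin> positions ?t h (2 * M)" if "k < 2 * ?N" for k
  proof -
    define q r where "q = k div ?t" and "r = k mod ?t"
    have k: "k = r + ?t * q" by (simp add: q_def r_def)
    have h: "0 < h" using that by (cases h) auto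
    have r: "r < ?t" using h by (simp add: r_def)
    have q: "q < 2 * M" using that runner_threshold[OF r, of "2 * M" q] by (simp add: k)
    obtain d where d: "2 * M = Suc (q + d)" using q less_iff_Suc_add by auto
    have "2 * ?N = ?t * (2 * M)" by simp
    also have "\<dots> = ?t * q + ?t * d + ?t" by (simp only: d) (simp add: algebra_simps)
    finally have "2 * ?N - 1 - k = (?t - 1 - r) + ?t * d" using r by (simp add: k)
    then have "(2 * ?N - 1 - k) mod ?t = ?t - 1 - r" using h by simp
    then show ?thesis using that r by (auto simp: mem_positions r_def[symmetric])
  qed
  moreover have "positions ?t h (2 * M) \<subseteq> {..<2 * ?N}" by (auto simp: mem_positions)
  ultimately show ?thesis by (simp add: antisymmetric_sets_def)
qed

text \<open>The choice on \<open>U\<close> is free and forces the rest: a position outside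
  \<open>U\<close> is a bead exactly when its mirror, which lies in \<open>U\<close>, is
  not.\<close>

lemma antisymmetric_bij:
  assumes U: "U \<in> antisymmetric_sets N"
  shows "bij_betw (\<lambda>T. T \<inter> U) (antisymmetric_sets N) (Pow U)"
proof (rule bij_betw_byWitness[of _ "\<lambda>Y. Y \<union> {k. k < 2 * N \<and> k \<notin> U \<and> 2 * N - 1 - k \<notin> Y}"])
  note mU = antisymmetric_mirror[OF U] and sU = antisymmetric_subset[OF U]
  show "\<forall>T\<in>antisymmetric_sets N. T \<inter> U \<union> {k. k < 2 * N \<and> k \<notin> U \<and> 2 * N - 1 - k \<notin> T \<inter> U} = T"
  proof
    fix T assume T: "T \<in> antisymmetric_sets N"
    show "T \<inter> U \<union> {k. k < 2 * N \<and> k \<notin> U \<and> 2 * N - 1 - k \<notin> T \<inter> U} = T"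
      using antisymmetric_mirror[OF T] antisymmetric_subset[OF T] mU by blast
  qed
  show "\<forall>Y\<in>Pow U. (Y \<union> {k. k < 2 * N \<and> k \<notin> U \<and> 2 * N - 1 - k \<notin> Y}) \<inter> U = Y" by blast
  show "(\<lambda>T. T \<inter> U) ` antisymmetric_sets N \<subseteq> Pow U" by blast
  show "(\<lambda>Y. Y \<union> {k. k < 2 * N \<and> k \<notin> U \<and> 2 * N - 1 - k \<notin> Y}) ` Pow U \<subseteq> antisymmetric_sets N"
  proof (rule image_subsetI)
    fix Y assume Y: "Y \<in> Pow U"
    define T where "T = Y \<union> {k. k < 2 * N \<and> k \<notin> U \<and> 2 * N - 1 - k \<notin> Y}"
    have "2 * N - 1 - k \<in> T \<longleftrightarrow> k \<notin> T" if k: "k < 2 * N" for k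
    proof -
      have inv: "2 * N - 1 - (2 * N - 1 - k) = k" "2 * N - 1 - k < 2 * N" using k by auto
      show ?thesis using mU[OF k] k Y unfolding T_def mem_Collect_eq Un_iff inv by (auto simp: inv)
    qed
    moreover have "T \<subseteq> {..<2 * N}" using Y sU by (auto simp: T_def)
    ultimately show "T \<in> antisymmetric_sets N" by (simp add: antisymmetric_sets_def)
  qed
qed

lemma antisymmetric_sets_finite: "finite (antisymmetric_sets N)"
  by (rule finite_subset[of _ "Pow {..<2 * N}"]) (auto simp: antisymmetric_sets_def)

text \<open>The moves inside \<open>U\<close> and those outside are exchanged by the mirror \<open>k \<mapsto> 2N - 1 - (k - t)\<close>.\<close>

lemma antisymmetric_card:
  assumes U: "U \<in> antisymmetric_sets N" and T: "T \<in> antisymmetric_sets N"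
    and shift: "\<And>k. t \<le> k \<Longrightarrow> k < 2 * N \<Longrightarrow> k - t \<in> U \<longleftrightarrow> k \<in> U"
  shows "card {k \<in> T. t \<le> k \<and> k - t \<notin> T} = 2 * card {k \<in> T \<inter> U. t \<le> k \<and> k - t \<notin> T \<inter> U}"
proof -
  note mU = antisymmetric_mirror[OF U] and sU = antisymmetric_subset[OF U]
  note mT = antisymmetric_mirror[OF T] and sT = antisymmetric_subset[OF T]
  let ?K = "{k \<in> T. t \<le> k \<and> k - t \<notin> T}"
  let ?m = "\<lambda>k. 2 * N - 1 - (k - t)"
  have fin: "finite ?K" using finite_subset[OF sT] by simp
  have m: "?m k \<in> ?K \<and> ?m (?m k) = k \<and> (?m k \<in> U \<longleftrightarrow> k \<notin> U)" if k: "k \<in> ?K" for k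
  proof -
    have lt: "k < 2 * N" using k sT by auto
    \<comment> \<open>The mirror of the gap \<open>k - t\<close> is a bead, and \<open>t\<close>
      places below it lies the mirror of the bead \<open>k\<close>, a gap.\<close>
    have 1: "?m k \<in> T" using mT[of "k - t"] k lt by auto
    have eq: "?m k - t = 2 * N - 1 - k" using k lt by auto
    have 2: "?m k - t \<notin> T" unfolding eq using mT[OF lt] k by auto
    have 3: "t \<le> ?m k" "?m (?m k) = k" using k lt by auto
    have 4: "?m k \<in> U \<longleftrightarrow> k \<notin> U" using mU[of "k - t"] shift[of k] k lt by auto
    show ?thesis using 1 2 3 4 by blast
  qed
  have "bij_betw ?m {k \<in> ?K. k \<in> U} {k \<in> ?K. k \<notin> U}"
    by (rule bij_betw_byWitness[of _ ?m]) (use m in blast)+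
  then have "card {k \<in> ?K. k \<in> U} = card {k \<in> ?K. k \<notin> U}" by (rule bij_betw_same_card)
  moreover have "card ?K = card {k \<in> ?K. k \<in> U} + card {k \<in> ?K. k \<notin> U}"
    using card_Int_Diff[OF fin, of U] by (simp add: Int_def set_diff_eq)
  moreover have "{k \<in> ?K. k \<in> U} = {k \<in> T \<inter> U. t \<le> k \<and> k - t \<notin> T \<inter> U}"
  proof -
    have "k < 2 * N" if "k \<in> T" for k using that sT by auto
    then show ?thesis using shift by blast
  qed
  ultimately show ?thesis by simp
qed

text \<open>Numbers the mirrored pairs outward from the middle: pair \<open>d\<close> is
  \<open>{N - 1 - d, N + d}\<close>.\<close>

definition fold_pos :: "nat \<Rightarrow> nat \<Rightarrow> nat" where
  "fold_pos N k = (if N \<le> k then k - N else N - 1 - k)"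

lemma weight_fold_pos: "weight N k = 2 * fold_pos N k + 1"
  by (simp add: weight_def fold_pos_def)

lemma fold_pos_bij:
  assumes U: "U \<in> antisymmetric_sets N"
  shows "bij_betw (fold_pos N) U {..<N}"
proof (rule bij_betw_byWitness[of _ "\<lambda>d. if N + d \<in> U then N + d else N - 1 - d"])
  note mU = antisymmetric_mirror[OF U] and sU = antisymmetric_subset[OF U]
  have mirror: "N - 1 - d \<in> U \<longleftrightarrow> N + d \<notin> U" if "d < N" for d
  proof -
    have "2 * N - 1 - (N + d) = N - 1 - d" using that by auto
    then show ?thesis using mU[of "N + d"] that by simp
  qed
  show "\<forall>k\<in>U. (if N + fold_pos N k \<in> U then N + fold_pos N k else N - 1 - fold_pos N k) = k"
  proof
    fix k assume k: "k \<in> U"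
    show "(if N + fold_pos N k \<in> U then N + fold_pos N k else N - 1 - fold_pos N k) = k"
    proof (cases "N \<le> k")
      case True
      then show ?thesis using k by (simp add: fold_pos_def)
    next
      case False
      then have "N - 1 - (N - 1 - k) = k" "N - 1 - k < N" by auto
      then show ?thesis using mirror[of "N - 1 - k"] k False by (simp add: fold_pos_def)
    qed
  qed
  show "\<forall>d\<in>{..<N}. fold_pos N (if N + d \<in> U then N + d else N - 1 - d) = d"
    by (auto simp: fold_pos_def)
  show "fold_pos N ` U \<subseteq> {..<N}" using sU by (auto simp: fold_pos_def)
  show "(\<lambda>d. if N + d \<in> U then N + d else N - 1 - d) ` {..<N} \<subseteq> U"
    using mirror by auto
qed

text \<open>Each pair contributes at least its lower element \<open>N - 1 - d\<close>, and these add
  up to \<open>\<Sum>{..<N}\<close>. Where the bead is the upper element, the excess is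
  \<open>2 * d + 1\<close>, the weight.\<close>

lemma antisymmetric_sum:
  assumes U: "U \<in> antisymmetric_sets N" and T: "T \<in> antisymmetric_sets N"
  shows "\<Sum>T = \<Sum>{..<N} + set_weight N U (T \<inter> U)"
proof -
  note mU = antisymmetric_mirror[OF U] and sU = antisymmetric_subset[OF U]
  note mT = antisymmetric_mirror[OF T] and sT = antisymmetric_subset[OF T]
  have finU: "finite U" using sU finite_subset by blast
  have finT: "finite T" using sT finite_subset by blast
  have "\<Sum>T = \<Sum>(T \<inter> U) + \<Sum>(T - U)" by (rule sum.Int_Diff[OF finT])
  \<comment> \<open>Beads outside \<open>U\<close> are traded for their mirror images, the gaps in
    \<open>U\<close>.\<close>
  also have "\<Sum>(T - U) = (\<Sum>k\<in>U - T. 2 * N - 1 - k)"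
  proof (rule sum.reindex_bij_betw[symmetric, where g = "\<lambda>k. k", simplified], 
      rule bij_betw_byWitness[of _ "\<lambda>k. 2 * N - 1 - k"])
    have lt: "k < 2 * N" if "k \<in> U \<union> T" for k using that sU sT by auto
    show "\<forall>k\<in>U - T. 2 * N - 1 - (2 * N - 1 - k) = k" using lt by force
    show "\<forall>k\<in>T - U. 2 * N - 1 - (2 * N - 1 - k) = k" using lt by force
    show "(\<lambda>k. 2 * N - 1 - k) ` (U - T) \<subseteq> T - U" using mT mU lt by blast
    show "(\<lambda>k. 2 * N - 1 - k) ` (T - U) \<subseteq> U - T" using mT mU lt by blast
  qed
  also have "\<Sum>(T \<inter> U) + (\<Sum>k\<in>U - T. 2 * N - 1 - k) = (\<Sum>k\<in>U. if k \<in> T then k else 2 * N - 1 - k)"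
    using finU by (subst sum.If_cases) (auto intro!: arg_cong2[of _ _ _ _ plus] sum.cong)
  also have "\<dots> = (\<Sum>k\<in>U. (N - Suc (fold_pos N k)) +
      (if (N \<le> k) = (k \<in> T \<inter> U) then weight N k else 0))"
    by (rule sum.cong) (use sU in \<open>auto simp: fold_pos_def weight_def\<close>)
  also have "\<dots> = (\<Sum>k\<in>U. N - Suc (fold_pos N k)) + set_weight N U (T \<inter> U)"
    by (simp only: sum.distrib set_weight_def)
  also have "(\<Sum>k\<in>U. N - Suc (fold_pos N k)) = (\<Sum>d<N. N - Suc d)"
    by (rule sum.reindex_bij_betw[OF fold_pos_bij[OF U]])
  also have "\<dots> = \<Sum>{..<N}" by (rule sum.nat_diff_reindex)
  finally show ?thesis .
qed

text \<open>Choices at different \<open>k\<close> are independent. Of the two options at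
  \<open>k\<close>, one costs nothing and the other costs the weight, whichever side of the middle
  \<open>k\<close> is on.\<close>

lemma sum_set_weight:
  assumes U: "U \<in> antisymmetric_sets N"
  shows "(\<Sum>Y\<in>Pow U. fps_X ^ set_weight N U Y) = (\<Prod>d<N. 1 + (fps_X :: 'a::comm_ring_1 fps) ^ (2 * d + 1))"
proof -
  have finU: "finite U" using antisymmetric_subset[OF U] finite_subset by blast
  let ?f = "\<lambda>k. if N \<le> k then fps_X ^ weight N k else (1 :: 'a fps)"
  let ?g = "\<lambda>k. if N \<le> k then (1 :: 'a fps) else fps_X ^ weight N k"
  have "fps_X ^ set_weight N U Y = prod ?f Y * prod ?g (U - Y)" if Y: "Y \<in> Pow U" for Y
  proof -
    have "(fps_X :: 'a fps) ^ set_weight N U Y = (\<Prod>k\<in>U. if k \<in> Y then ?f k else ?g k)"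
      unfolding set_weight_def power_sum by (rule prod.cong) auto
    also have "\<dots> = prod ?f (U \<inter> Y) * prod ?g (U \<inter> - Y)"
      using finU by (subst prod.If_cases) simp_all
    also have "U \<inter> Y = Y" using Y by auto
    finally show ?thesis by (simp only: Diff_eq)
  qed
  then have "(\<Sum>Y\<in>Pow U. fps_X ^ set_weight N U Y) = (\<Prod>k\<in>U. ?f k + ?g k)"
    unfolding prod_add[OF finU] by (rule sum.cong[OF refl])
  also have "\<dots> = (\<Prod>k\<in>U. 1 + fps_X ^ (2 * fold_pos N k + 1))"
    by (rule prod.cong) (auto simp: weight_fold_pos)
  also have "\<dots> = (\<Prod>d<N. 1 + fps_X ^ (2 * d + 1))"
    by (rule prod.reindex_bij_betw[OF fold_pos_bij[OF U]])
  finally show ?thesis .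
qed

subsection \<open>Comparison of coefficients\<close>

lemma fps_X_power_dvd_iff:
  fixes f :: "'a::comm_ring_1 fps"
  shows "fps_X ^ n dvd f \<longleftrightarrow> (\<forall>i<n. fps_nth f i = 0)"
proof
  assume "\<forall>i<n. fps_nth f i = 0"
  then have "f = fps_X ^ n * fps_shift n f"
    by (auto simp: fps_eq_iff fps_X_power_mult_nth)
  then show "fps_X ^ n dvd f" by (rule dvdI)
qed (auto simp: dvd_def fps_X_power_mult_nth)

text \<open>Factor \<open>j\<close> is 1 modulo \<open>fps_X ^ Suc j\<close>, so each coefficient of
  the partial products becomes constant.\<close>

lemma qpoch_inf_cong:
  fixes a b :: "'a::comm_ring_1 fps"
  assumes "fps_X dvd a" and "fps_X dvd b" and "n \<le> K"
  shows "fps_X ^ n dvd qpoch_inf a b - (\<Prod>j<K. 1 - a * b ^ j)"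
proof -
  define P where "P K = (\<Prod>j<K. 1 - a * b ^ j)" for K
  \<comment> \<open>The coefficient of index \<open>n\<close> no longer changes after
    \<open>n\<close> factors, so it can be read off \<open>P n\<close>.\<close>
  define L where "L = Abs_fps (\<lambda>n. fps_nth (P n) n)"
  have "fps_X ^ Suc m dvd P m' - P m" if "m \<le> m'" for m m'
    unfolding P_def
  proof (rule prod_one_plus_cong)
    fix j assume "j \<in> {..<m'} - {..<m}"
    then have "fps_X ^ Suc m dvd fps_X ^ Suc j" by (intro le_imp_power_dvd) auto
    also have "fps_X ^ Suc j dvd a * b ^ j"
      unfolding power_Suc using assms by (intro mult_dvd_mono dvd_power_same)
    finally show "fps_X ^ Suc m dvd 1 - a * b ^ j - 1" by simp
  qed (use that in auto)
  then have P: "fps_nth (P m') m = fps_nth L m" if "m \<le> m'" for m m'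
    using that by (simp add: fps_X_power_dvd_iff L_def del: power_Suc)
  have "P \<longlonglongrightarrow> L"
    by (rule tendsto_fpsI) (use P in \<open>auto simp: eventually_sequentially\<close>)
  then have "qpoch_inf a b = L" unfolding qpoch_inf_def P_def by (rule limI)
  then show ?thesis
    using P assms(3) by (simp add: fps_X_power_dvd_iff flip: P_def)
qed

lemma dvd_diff_power:
  fixes a b :: "'a::comm_ring_1"
  assumes "m dvd a - b"
  shows "m dvd a ^ n - b ^ n"
  by (induction n) (use dvd_diff_mult_trans[OF assms] in auto)

lemma partition_length_le_psize: "is_partition lam \<Longrightarrow> length lam \<le> psize lam"
  by (induction lam) (auto simp: is_partition_def psize_def)

lemma self_conjugate_n_hook:
  assumes "self_conjugate lam" and "length lam \<le> N" and "0 < t"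
  shows "n_hook t lam = card {k \<in> bead_set N (nth_default 0 lam). t \<le> k \<and> k - t \<notin> bead_set N (nth_default 0 lam)}"
proof -
  let ?l = "nth_default 0 lam"
  interpret conjugate_pair ?l ?l N by (rule self_conjugate_pair[OF assms(1,2)])
  have conj: "conj_part lam = lam" using assms(1) by (simp add: self_conjugate_def)
  have diagram: "in_diagram lam i j \<longleftrightarrow> j < ?l i" for i j
    by (simp add: in_diagram_def nth_default_def)
  have "hook_length lam i j = (?l i - j - 1) + (?l j - i - 1) + 1" if "j < ?l i" for i j
  proof -
    \<comment> \<open>The reflected cell is in the diagram too, so both list accesses in
      \<open>hook_length\<close> are in range.\<close>
    have "i < ?l j" using galois that by simp
    then have "i < length lam" "j < length lam"
      using that by (auto simp: nth_default_def split: if_splits)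
    then show ?thesis by (simp add: hook_length_def conj nth_default_nth)
  qed
  then have "{(i, j). in_diagram lam i j \<and> hook_length lam i j = t} =
      {(i, j). j < ?l i \<and> (?l i - j - 1) + (?l j - i - 1) + 1 = t}"
    by (auto simp: diagram)
  then show ?thesis using card_hooks[OF assms(3)] by (simp add: n_hook_def beads_eq)
qed

lemma self_conjugate_psize:
  assumes "self_conjugate lam" and "length lam \<le> N"
  shows "\<Sum>(bead_set N (nth_default 0 lam)) = psize lam + \<Sum>{..<N}"
proof -
  interpret conjugate_pair "nth_default 0 lam" "nth_default 0 lam" N
    by (rule self_conjugate_pair[OF assms])
  show ?thesis using sum_beads by (simp add: beads_eq psize_eq_sum[OF assms(2)])
qed

text \<open>Partitions in the box correspond to subsets of \<open>U\<close>. By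
  \<open>antisymmetric_card\<close> each move inside \<open>U\<close> counts twice, which is why the
  variable is the square \<open>monom 1 2\<close>.\<close>

lemma sum_self_conjugate:
  fixes h M :: nat
  defines "t \<equiv> 2 * h" and "N \<equiv> 2 * h * M"
  assumes "0 < h"
  shows "(\<Sum>lam | self_conjugate lam \<and> length lam \<le> N.
      fps_const (monom (1::int) (n_hook t lam)) * fps_X ^ psize lam)
    = (\<Prod>r<h. runner_gf t M r (fps_const (monom 1 2)))"
proof -
  define U where "U = positions t h (2 * M)"
  define y :: "int poly fps" where "y = fps_const (monom 1 2)"
  define m where "m Y = card {k \<in> Y. t \<le> k \<and> k - t \<notin> Y}" for Y
  have U: "U \<in> antisymmetric_sets N"
    unfolding U_def t_def N_def by (rule positions_antisymmetric)
  have shift: "k - t \<in> U \<longleftrightarrow> k \<in> U" if "t \<le> k" "k < 2 * N" for k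
  proof -
    have "(k - t) mod t = k mod t" using that(1) by (simp add: le_mod_geq)
    moreover have "k - t < t * (2 * M)" "k < t * (2 * M)" using that by (auto simp: t_def N_def)
    ultimately show ?thesis by (simp add: U_def mem_positions t_def)
  qed
  let ?b = "\<lambda>lam. bead_set N (nth_default 0 lam)"
  let ?S = "{lam. self_conjugate lam \<and> length lam \<le> N}"
  have bij: "bij_betw (\<lambda>lam. ?b lam \<inter> U) ?S (Pow U)"
    using bij_betw_trans[OF self_conjugate_bij antisymmetric_bij[OF U]] by (simp add: o_def)
  have "fps_const (monom 1 (n_hook t lam)) * fps_X ^ psize lam
      = y ^ m (?b lam \<inter> U) * fps_X ^ set_weight N U (?b lam \<inter> U)" if lam: "lam \<in> ?S" for lam
  proof -
    have T: "?b lam \<in> antisymmetric_sets N"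
      using bij_betwE[OF self_conjugate_bij] lam by blast
    have "n_hook t lam = 2 * m (?b lam \<inter> U)"
      using self_conjugate_n_hook[of lam N t] antisymmetric_card[OF U T shift] lam assms(3)
      by (simp add: m_def t_def)
    moreover have "psize lam = set_weight N U (?b lam \<inter> U)"
      using self_conjugate_psize[of lam N] antisymmetric_sum[OF U T] lam by simp
    ultimately show ?thesis by (simp add: y_def fps_const_power monom_power)
  qed
  then have "(\<Sum>lam\<in>?S. fps_const (monom 1 (n_hook t lam)) * fps_X ^ psize lam)
      = (\<Sum>Y\<in>Pow U. y ^ m Y * fps_X ^ set_weight N U Y)"
    unfolding sum.reindex_bij_betw[OF bij, symmetric] by (rule sum.cong[OF refl])
  also have "\<dots> = (\<Prod>r<h. runner_gf t M r y)"
    unfolding U_def m_def N_def t_def by (rule sum_positions_eq_prod) simp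
  finally show ?thesis by (simp only: y_def)
qed

text \<open>No single runner is evaluated: at \<open>y = 1\<close> the product is the sum over all
  subsets of \<open>positions\<close> by weight alone, known from
  \<open>sum_set_weight\<close>.\<close>

lemma prod_runner_gf_1:
  "(\<Prod>r<h. runner_gf (2 * h) M r 1) = (\<Prod>d<2 * h * M. 1 + (fps_X :: 'a::comm_ring_1 fps) ^ (2 * d + 1))"
proof -
  let ?U = "positions (2 * h) h (2 * M)"
  have "(\<Prod>r<h. runner_gf (2 * h) M r 1) =
      (\<Sum>Y\<in>Pow ?U. (fps_X :: 'a fps) ^ set_weight (2 * h * M) ?U Y)"
    using sum_positions_eq_prod[of h "2 * h" "1 :: 'a fps" M] by simp
  also have "\<dots> = (\<Prod>d<2 * h * M. 1 + fps_X ^ (2 * d + 1))"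
    by (rule sum_set_weight[OF positions_antisymmetric])
  finally show ?thesis .
qed

theorem theorem1p1:
  fixes t :: nat
  assumes "0 < t" and "even t"
  shows "sc_hook_gf t =
    qpoch_inf (- fps_X) (fps_X ^ 2) *
    qpoch_inf (fps_const (1 - monom 1 2) * fps_X ^ (2 * t)) (fps_X ^ (2 * t)) ^ (t div 2)"
proof (rule fps_ext)
  fix n
  obtain h where t: "t = 2 * h" using assms(2) by (elim evenE)
  have h: "0 < h" "t div 2 = h" using assms(1) t by auto
  \<comment> \<open>Congruence modulo \<open>fps_X ^ Suc n\<close> determines the coefficient of
    index \<open>n\<close>.\<close>
  define M where "M = Suc n"
  define N where "N = t * M"
  let ?q1 = "qpoch_inf (- fps_X) (fps_X ^ 2) :: int poly fps"
  let ?q2 = "qpoch_inf (fps_const (1 - monom 1 2) * fps_X ^ (2 * t)) (fps_X ^ (2 * t)) :: int poly fps"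
  define y :: "int poly fps" where "y = fps_const (monom 1 2)"
  define W where "W = (\<Prod>k<2 * M. 1 + (y - 1) * (fps_X ^ (2 * t)) ^ Suc k)"
  define P :: "int poly fps" where "P = (\<Prod>d<N. 1 + fps_X ^ (2 * d + 1))"
  let ?S = "{lam. self_conjugate lam \<and> length lam \<le> N}"
  define F where "F = (\<Sum>lam\<in>?S. fps_const (monom (1::int) (n_hook t lam)) * fps_X ^ psize lam)"
  have finS: "finite ?S"
    using bij_betw_finite[OF self_conjugate_bij] antisymmetric_sets_finite by blast
  have "M \<le> N" using assms(1) by (simp add: N_def)
  \<comment> \<open>A partition of \<open>n\<close> has at most \<open>n\<close> parts, so it fits
    into the box of side \<open>N\<close>.\<close>
  have eq: "{lam. self_conjugate lam \<and> psize lam = n} = {lam \<in> ?S. psize lam = n}"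
    using partition_length_le_psize \<open>M \<le> N\<close> by (fastforce simp: M_def self_conjugate_def)
  have coeff: "fps_nth (sc_hook_gf t) n = fps_nth F n"
    unfolding sc_hook_gf_def F_def fps_nth_Abs_fps eq fps_sum_nth
    by (subst sum.inter_filter[OF finS]) (rule sum.cong, auto)
  have dvd_X: "fps_X dvd (fps_X :: int poly fps) ^ (2 * t)" using assms(1) by (simp add: dvd_power)
  have 1: "fps_X ^ M dvd F - W ^ h * P"
    using prod_runner_gf_cong[of h t M y] sum_self_conjugate[OF h(1), of M] 
    by (simp add: F_def W_def P_def N_def y_def t prod_runner_gf_1 del: power_Suc)
  have 2: "fps_X ^ M dvd ?q1 - P"
  proof -
    have "P = (\<Prod>j<N. 1 - (- fps_X) * (fps_X ^ 2) ^ j)"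
      unfolding P_def by (rule prod.cong) (simp_all add: power_mult)
    then show ?thesis using qpoch_inf_cong[of "- fps_X" "fps_X ^ 2" M N] \<open>M \<le> N\<close> by simp
  qed
  have 3: "fps_X ^ M dvd ?q2 - W"
  proof -
    have "W = (\<Prod>j<2 * M. 1 - (fps_const (1 - monom 1 2) * fps_X ^ (2 * t)) * (fps_X ^ (2 * t)) ^ j)"
      unfolding W_def y_def by (rule prod.cong) (simp_all add: algebra_simps flip: fps_const_sub)
    then show ?thesis
      using qpoch_inf_cong[OF _ dvd_X, of "fps_const (1 - monom 1 2) * fps_X ^ (2 * t)" M "2 * M"] dvd_X by simp
  qed
  have "fps_X ^ M dvd ?q1 * ?q2 ^ h - P * W ^ h"
    by (intro dvd_diff_mult_trans dvd_diff_power 2 3)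
  from dvd_diff[OF 1 this] have "fps_X ^ M dvd F - ?q1 * ?q2 ^ h" by (simp add: mult.commute)
  then have "fps_nth F n = fps_nth (?q1 * ?q2 ^ h) n"
    by (simp add: fps_X_power_dvd_iff M_def del: power_Suc)
  then show "fps_nth (sc_hook_gf t) n = fps_nth (?q1 * ?q2 ^ (t div 2)) n"
    by (simp only: coeff h)
qed

end
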